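(* There exists a (geodesically) incomplete left invariant Lorentzian metric on $G:=\mathrm{Sol}\times\mathbb{R}$ together with a central null Killing field $V$. Moreover, for a cocompact lattice $\Gamma$ of $G$, the quotient $M:=\Gamma\backslash G$ with the induced metric is an incomplete compact Lorentzian manifold on which the flow of $V$ acts isometrically.
   Context: $\mathrm{Sol}=\mathbb{R}\ltimes\mathbb{R}^2$, where $t\in\mathbb{R}$ acts on $\mathbb{R}^2$ by $\mathrm{diag}(e^t,e^{-t})$. A central null Killing field here means a left invariant vector field $V$ on $G$ generated by a nonzero element of the center of the Lie algebra of $G$, which is a Killing field for the metric and satisfies $g(V,V)=0$ everywhere. $V$ descends to a vector field on $\Gamma\backslash G$. A Lorentzian manifold is complete if every geodesic extends to one defined on all of $\mathbb{R}$, and incomplete otherwise. *)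

theory Defs
  imports "HOL-Analysis.Analysis" "HOL-Algebra.Coset"
begin

section \<open>Smooth maps between open subsets of Euclidean spaces\<close>

text \<open>The set \<open>S\<close> is meant to be open; the derivatives of order \<open>\<le> k\<close> are taken in all directions.\<close>

primrec Ck_on :: "nat \<Rightarrow> ('e::euclidean_space \<Rightarrow> 'f::real_normed_vector) \<Rightarrow> 'e set \<Rightarrow> bool" where
  "Ck_on 0 = (\<lambda>f S. continuous_on S f)"
| "Ck_on (Suc k) = (\<lambda>f S. f differentiable_on S \<and>
      (\<forall>v. Ck_on k (\<lambda>x. frechet_derivative f (at x) v) S))"

definition smooth_on :: "'e set \<Rightarrow> ('e::euclidean_space \<Rightarrow> 'f::real_normed_vector) \<Rightarrow> bool" where
  "smooth_on S f \<longleftrightarrow> (\<forall>k. Ck_on k f S)"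


section \<open>Smooth manifolds\<close>

text \<open>A manifold is a topological space with a (not necessarily maximal) smooth atlas. A chart
  \<open>(U, \<phi>)\<close> has a total function \<open>\<phi>\<close>, of which only the values on \<open>U\<close> matter.\<close>

type_synonym ('a, 'e) chart = "'a set \<times> ('a \<Rightarrow> 'e)"

record ('a, 'e) premanifold =
  top_of :: "'a topology"
  atlas :: "('a, 'e) chart set"

abbreviation points :: "('a, 'e, 'z) premanifold_scheme \<Rightarrow> 'a set" where
  "points M \<equiv> topspace (top_of M)"

abbreviation chart_inv :: "('a, 'e) chart \<Rightarrow> 'e \<Rightarrow> 'a" where
  "chart_inv c \<equiv> inv_into (fst c) (snd c)"

definition transition :: "('a, 'e) chart \<Rightarrow> ('a, 'e) chart \<Rightarrow> 'e \<Rightarrow> 'e" where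
  "transition c d = snd d \<circ> chart_inv c"

definition is_chart :: "'a topology \<Rightarrow> ('a, 'e::euclidean_space) chart \<Rightarrow> bool" where
  "is_chart X c \<longleftrightarrow> openin X (fst c) \<and> open (snd c ` fst c) \<and>
     homeomorphic_map (subtopology X (fst c)) (top_of_set (snd c ` fst c)) (snd c)"

definition smooth_manifold :: "('a, 'e::euclidean_space) premanifold \<Rightarrow> bool" where
  "smooth_manifold M \<longleftrightarrow>
     Hausdorff_space (top_of M) \<and> second_countable (top_of M) \<and>
     (\<forall>c\<in>atlas M. is_chart (top_of M) c) \<and>
     (\<Union>c\<in>atlas M. fst c) = points M \<and>
     (\<forall>c\<in>atlas M. \<forall>d\<in>atlas M. smooth_on (snd c ` (fst c \<inter> fst d)) (transition c d))"

definition smooth_map ::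
  "('a, 'e::euclidean_space) premanifold \<Rightarrow> ('b, 'f::euclidean_space) premanifold \<Rightarrow> ('a \<Rightarrow> 'b) \<Rightarrow> bool" where
  "smooth_map M N f \<longleftrightarrow> continuous_map (top_of M) (top_of N) f \<and>
     (\<forall>c\<in>atlas M. \<forall>d\<in>atlas N.
        smooth_on (snd c ` {p \<in> fst c. f p \<in> fst d}) (snd d \<circ> f \<circ> chart_inv c))"

definition diffeomorphism ::
  "('a, 'e::euclidean_space) premanifold \<Rightarrow> ('b, 'f::euclidean_space) premanifold \<Rightarrow> ('a \<Rightarrow> 'b) \<Rightarrow> bool" where
  "diffeomorphism M N f \<longleftrightarrow> smooth_map M N f \<and>
     (\<exists>h. smooth_map N M h \<and> (\<forall>p\<in>points M. h (f p) = p) \<and> (\<forall>q\<in>points N. f (h q) = q))"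


section \<open>Vector fields and flows\<close>

text \<open>A tangent vector at \<open>p\<close> is given by its components in the charts around \<open>p\<close>, which
  transform by the derivative of the transition maps. For a vector field \<open>V\<close>, the vector \<open>V c p\<close>
  consists of the components of \<open>V\<close> at \<open>p\<close> in the chart \<open>c\<close>.\<close>

type_synonym ('a, 'e) vfield = "('a, 'e) chart \<Rightarrow> 'a \<Rightarrow> 'e"

definition smooth_vector_field ::
  "('a, 'e::euclidean_space) premanifold \<Rightarrow> ('a, 'e) vfield \<Rightarrow> bool" where
  "smooth_vector_field M V \<longleftrightarrow>
     (\<forall>c\<in>atlas M. smooth_on (snd c ` fst c) (\<lambda>x. V c (chart_inv c x))) \<and>
     (\<forall>c\<in>atlas M. \<forall>d\<in>atlas M. \<forall>p\<in>fst c \<inter> fst d.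
        V d p = frechet_derivative (transition c d) (at (snd c p)) (V c p))"

definition integral_curve ::
  "('a, 'e::euclidean_space) premanifold \<Rightarrow> ('a, 'e) vfield \<Rightarrow> (real \<Rightarrow> 'a) \<Rightarrow> bool" where
  "integral_curve M V \<gamma> \<longleftrightarrow> continuous_map euclidean (top_of M) \<gamma> \<and>
     (\<forall>c\<in>atlas M. \<forall>t. \<gamma> t \<in> fst c \<longrightarrow>
        ((snd c \<circ> \<gamma>) has_vector_derivative V c (\<gamma> t)) (at t))"

text \<open>Global flow; on a smooth Hausdorff manifold it is uniquely determined by \<open>V\<close> on the points
  of \<open>M\<close>.\<close>

definition is_flow ::
  "('a, 'e::euclidean_space) premanifold \<Rightarrow> ('a, 'e) vfield \<Rightarrow> (real \<Rightarrow> 'a \<Rightarrow> 'a) \<Rightarrow> bool" where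
  "is_flow M V \<Phi> \<longleftrightarrow>
     (\<forall>p\<in>points M. \<Phi> 0 p = p \<and> integral_curve M V (\<lambda>t. \<Phi> t p) \<and>
        (\<forall>s t. \<Phi> (s + t) p = \<Phi> s (\<Phi> t p)))"


section \<open>Lorentzian manifolds\<close>

text \<open>Signature \<open>(-,+,\<dots>,+)\<close>: there is an orthonormal basis with exactly one timelike vector.\<close>

definition lorentz_form :: "('e::euclidean_space \<Rightarrow> 'e \<Rightarrow> real) \<Rightarrow> bool" where
  "lorentz_form b \<longleftrightarrow> bilinear b \<and> (\<forall>u v. b u v = b v u) \<and>
     (\<exists>B. \<exists>e\<in>B. independent B \<and> span B = UNIV \<and> b e e = -1 \<and>
        (\<forall>u\<in>B - {e}. b u u = 1) \<and> (\<forall>u\<in>B. \<forall>v\<in>B. u \<noteq> v \<longrightarrow> b u v = 0))"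

text \<open>\<open>g c p u v\<close> is the scalar product at \<open>p\<close> of the tangent vectors with components \<open>u\<close> and
  \<open>v\<close> in the chart \<open>c\<close>.\<close>

type_synonym ('a, 'e) metric = "('a, 'e) chart \<Rightarrow> 'a \<Rightarrow> 'e \<Rightarrow> 'e \<Rightarrow> real"

definition lorentzian_manifold ::
  "('a, 'e::euclidean_space) premanifold \<Rightarrow> ('a, 'e) metric \<Rightarrow> bool" where
  "lorentzian_manifold M g \<longleftrightarrow> smooth_manifold M \<and>
     (\<forall>c\<in>atlas M. \<forall>p\<in>fst c. lorentz_form (g c p)) \<and>
     (\<forall>c\<in>atlas M. \<forall>u v. smooth_on (snd c ` fst c) (\<lambda>x. g c (chart_inv c x) u v)) \<and>
     (\<forall>c\<in>atlas M. \<forall>d\<in>atlas M. \<forall>p\<in>fst c \<inter> fst d. \<forall>u v.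
        g d p (frechet_derivative (transition c d) (at (snd c p)) u)
              (frechet_derivative (transition c d) (at (snd c p)) v) = g c p u v)"

definition isometry ::
  "('a, 'e::euclidean_space) premanifold \<Rightarrow> ('a, 'e) metric \<Rightarrow> ('a \<Rightarrow> 'a) \<Rightarrow> bool" where
  "isometry M g f \<longleftrightarrow> diffeomorphism M M f \<and>
     (\<forall>c\<in>atlas M. \<forall>d\<in>atlas M. \<forall>p\<in>fst c. f p \<in> fst d \<longrightarrow> (\<forall>u v.
        g d (f p) (frechet_derivative (snd d \<circ> f \<circ> chart_inv c) (at (snd c p)) u)
                  (frechet_derivative (snd d \<circ> f \<circ> chart_inv c) (at (snd c p)) v) = g c p u v))"

text \<open>Christoffel symbols of the Levi-Civita connection of a metric \<open>h\<close> in coordinates: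
  \<open>christoffel h x u v\<close> is the vector with components \<open>\<Gamma>\<^sup>k\<^sub>i\<^sub>j(x) u\<^sup>i v\<^sup>j\<close>, characterised by lowering
  the index \<open>k\<close>.\<close>

definition christoffel ::
  "('e::euclidean_space \<Rightarrow> 'e \<Rightarrow> 'e \<Rightarrow> real) \<Rightarrow> 'e \<Rightarrow> 'e \<Rightarrow> 'e \<Rightarrow> 'e" where
  "christoffel h x u v = (THE w. \<forall>z. h x w z =
     (frechet_derivative (\<lambda>y. h y v z) (at x) u
    + frechet_derivative (\<lambda>y. h y u z) (at x) v
    - frechet_derivative (\<lambda>y. h y u v) (at x) z) / 2)"

text \<open>In a chart: \<open>x'' + \<Gamma>(x', x') = 0\<close>, where \<open>v\<close> is the velocity \<open>x'\<close> close to \<open>t\<close>.\<close>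

definition geodesic_on ::
  "('a, 'e::euclidean_space) premanifold \<Rightarrow> ('a, 'e) metric \<Rightarrow> real set \<Rightarrow> (real \<Rightarrow> 'a) \<Rightarrow> bool" where
  "geodesic_on M g I \<gamma> \<longleftrightarrow> continuous_map (top_of_set I) (top_of M) \<gamma> \<and>
     (\<forall>c\<in>atlas M. \<forall>t\<in>I. \<gamma> t \<in> fst c \<longrightarrow> (\<exists>v.
        (\<forall>\<^sub>F s in nhds t. ((snd c \<circ> \<gamma>) has_vector_derivative v s) (at s)) \<and>
        (v has_vector_derivative
           - christoffel (\<lambda>x. g c (chart_inv c x)) (snd c (\<gamma> t)) (v t) (v t)) (at t)))"

definition geodesically_complete ::
  "('a, 'e::euclidean_space) premanifold \<Rightarrow> ('a, 'e) metric \<Rightarrow> bool" where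
  "geodesically_complete M g \<longleftrightarrow>
     (\<forall>I \<gamma>. open I \<and> is_interval I \<and> I \<noteq> {} \<and> geodesic_on M g I \<gamma> \<longrightarrow>
        (\<exists>\<gamma>'. geodesic_on M g UNIV \<gamma>' \<and> (\<forall>t\<in>I. \<gamma>' t = \<gamma> t)))"


section \<open>The Lie group \<open>Sol \<times> \<real>\<close>\<close>

definition Sol :: "(real \<times> real \<times> real) monoid" where
  "Sol = \<lparr>carrier = UNIV,
          mult = (\<lambda>(t, x, y) (t', x', y'). (t + t', x + exp t * x', y + exp (- t) * y')),
          one = (0, 0, 0)\<rparr>"

definition Radd :: "real monoid" where
  "Radd = \<lparr>carrier = UNIV, mult = (+), one = 0\<rparr>"

type_synonym solR = "(real \<times> real \<times> real) \<times> real"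

definition SolR :: "solR monoid" where
  "SolR = Sol \<times>\<times> Radd"

lemma group_Sol: "group Sol"
proof (rule groupI)
  fix p assume "p \<in> carrier Sol"
  obtain t x y where p: "p = (t, x, y)" by (cases p)
  have "(- t, - exp (- t) * x, - exp t * y) \<otimes>\<^bsub>Sol\<^esub> p = \<one>\<^bsub>Sol\<^esub>"
    by (simp add: p Sol_def)
  then show "\<exists>q\<in>carrier Sol. q \<otimes>\<^bsub>Sol\<^esub> p = \<one>\<^bsub>Sol\<^esub>"
    by (rule bexI) (simp add: Sol_def)
qed (auto simp: Sol_def algebra_simps exp_add exp_minus)

lemma group_SolR: "group SolR"
proof -
  have "group Radd"
    by (rule groupI) (auto simp: Radd_def intro: exI[of _ "- _"])
  then show ?thesis
    unfolding SolR_def by (rule DirProd_group[OF group_Sol])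
qed

text \<open>As a manifold, \<open>Sol \<times> \<real>\<close> is \<open>\<real>\<^sup>4\<close> with its single global chart; its tangent spaces are
  identified with \<open>\<real>\<^sup>4\<close> accordingly, and metrics and vector fields on it are written without
  reference to the chart.\<close>

definition SolR_manifold :: "(solR, solR) premanifold" where
  "SolR_manifold = \<lparr>top_of = euclidean, atlas = {(UNIV, id)}\<rparr>"

definition left_translate :: "solR \<Rightarrow> solR \<Rightarrow> solR \<Rightarrow> solR" where
  "left_translate a p = frechet_derivative (\<lambda>q. a \<otimes>\<^bsub>SolR\<^esub> q) (at p)"

definition left_invariant_metric :: "(solR \<Rightarrow> solR \<Rightarrow> solR \<Rightarrow> real) \<Rightarrow> bool" where
  "left_invariant_metric g \<longleftrightarrow>
     (\<forall>a p u v. g (a \<otimes>\<^bsub>SolR\<^esub> p) (left_translate a p u) (left_translate a p v) = g p u v)"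

text \<open>The Lie algebra is the tangent space at the identity, with the bracket of left invariant
  vector fields.\<close>

definition left_field :: "solR \<Rightarrow> solR \<Rightarrow> solR" where
  "left_field \<xi> p = left_translate p \<one>\<^bsub>SolR\<^esub> \<xi>"

definition field_bracket :: "('e::euclidean_space \<Rightarrow> 'e) \<Rightarrow> ('e \<Rightarrow> 'e) \<Rightarrow> 'e \<Rightarrow> 'e" where
  "field_bracket X Y p = frechet_derivative Y (at p) (X p) - frechet_derivative X (at p) (Y p)"

definition lie_bracket :: "solR \<Rightarrow> solR \<Rightarrow> solR" where
  "lie_bracket \<xi> \<eta> = field_bracket (left_field \<xi>) (left_field \<eta>) \<one>\<^bsub>SolR\<^esub>"

definition lie_center :: "solR set" where
  "lie_center = {\<xi>. \<forall>\<eta>. lie_bracket \<xi> \<eta> = 0}"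

text \<open>The Lie derivative of the metric along \<open>V\<close> vanishes.\<close>

definition killing_field ::
  "('e::euclidean_space \<Rightarrow> 'e \<Rightarrow> 'e \<Rightarrow> real) \<Rightarrow> ('e \<Rightarrow> 'e) \<Rightarrow> bool" where
  "killing_field g V \<longleftrightarrow> (\<forall>p u w.
     frechet_derivative (\<lambda>q. g q u w) (at p) (V p)
   + g p (frechet_derivative V (at p) u) w
   + g p u (frechet_derivative V (at p) w) = 0)"

definition central_null_killing ::
  "(solR \<Rightarrow> solR \<Rightarrow> solR \<Rightarrow> real) \<Rightarrow> (solR \<Rightarrow> solR) \<Rightarrow> bool" where
  "central_null_killing g V \<longleftrightarrow>
     (\<exists>\<xi>\<in>lie_center. \<xi> \<noteq> 0 \<and> V = left_field \<xi>) \<and>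
     killing_field g V \<and> (\<forall>p. g p (V p) (V p) = 0)"


section \<open>Quotients of \<open>Sol \<times> \<real>\<close> by subgroups acting from the left\<close>

text \<open>The points of \<open>\<Gamma>\G\<close> are the cosets \<open>\<Gamma> p\<close>.\<close>

abbreviation proj :: "solR set \<Rightarrow> solR \<Rightarrow> solR set" where
  "proj \<Gamma> p \<equiv> \<Gamma> #>\<^bsub>SolR\<^esub> p"

definition quotient_top :: "solR set \<Rightarrow> solR set topology" where
  "quotient_top \<Gamma> = topology (\<lambda>U. U \<subseteq> rcosets\<^bsub>SolR\<^esub> \<Gamma> \<and> open (proj \<Gamma> -` U))"

lemma openin_quotient_top:
  "openin (quotient_top \<Gamma>) U \<longleftrightarrow> U \<subseteq> rcosets\<^bsub>SolR\<^esub> \<Gamma> \<and> open (proj \<Gamma> -` U)"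
proof -
  have "istopology (\<lambda>U. U \<subseteq> rcosets\<^bsub>SolR\<^esub> \<Gamma> \<and> open (proj \<Gamma> -` U))"
    unfolding istopology_def by (auto simp: vimage_Int vimage_Union)
  then show ?thesis
    by (simp add: quotient_top_def topology_inverse')
qed

definition cocompact_lattice :: "solR set \<Rightarrow> bool" where
  "cocompact_lattice \<Gamma> \<longleftrightarrow>
     subgroup \<Gamma> SolR \<and> discrete \<Gamma> \<and> compact_space (quotient_top \<Gamma>)"

text \<open>The charts of \<open>\<Gamma>\G\<close> are the local inverses of the projection, which is thereby a local
  diffeomorphism.\<close>

definition quotient_manifold :: "solR set \<Rightarrow> (solR set, solR) premanifold" where
  "quotient_manifold \<Gamma> = \<lparr>top_of = quotient_top \<Gamma>,
     atlas = {(proj \<Gamma> ` U, inv_into U (proj \<Gamma>)) | U. open U \<and> inj_on (proj \<Gamma>) U}\<rparr>"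

text \<open>In the chart given by a local section \<open>\<sigma>\<close> of the projection, the induced metric and the
  projected vector field have at \<open>q\<close> the components of the given ones at \<open>\<sigma> q\<close>. These are the
  unique candidates making the projection a local isometry, and \<open>V\<close> and its projection related.\<close>

definition quotient_metric ::
  "(solR \<Rightarrow> solR \<Rightarrow> solR \<Rightarrow> real) \<Rightarrow> (solR set, solR) metric" where
  "quotient_metric g c q = g (snd c q)"

definition quotient_field :: "(solR \<Rightarrow> solR) \<Rightarrow> (solR set, solR) vfield" where
  "quotient_field V c q = V (snd c q)"

end

theory Submission
  imports Defs
begin

text \<open>
  Write points of \<open>Sol \<times> \<real>\<close> as \<open>(t, x, y, z)\<close>. The left invariant coframe \<open>dt\<close>, \<open>e\<^sup>-\<^sup>t dx\<close>,
  \<open>e\<^sup>t dy\<close>, \<open>dz\<close> gives the left invariant Lorentzian metric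
  \<open>g = dt\<^sup>2 + e\<^sup>2\<^sup>t dy\<^sup>2 + 2 e\<^sup>-\<^sup>t dx dz\<close>. Its coefficients do not involve \<open>z\<close> and it has no \<open>dz\<^sup>2\<close>
  term, so the central field \<open>V = \<partial>\<^sub>z\<close> is Killing and null.

  Incompleteness comes from the equation for the velocity. Geodesics with \<open>y' = 0\<close> satisfy
  \<open>t'' = - e\<^sup>-\<^sup>t x' z'\<close>, and for null ones the right-hand side is \<open>t'\<^sup>2 / 2\<close>. This Riccati
  equation blows up in finite time, for instance with \<open>t' = - 2 / s\<close>. Integrating the
  remaining equations gives the null geodesic \<open>(- 2 ln s, - 1 / s, 0, 2 / s)\<close> for \<open>s > 0\<close>.

  The blow-up survives in every quotient by a discrete subgroup \<open>\<Gamma>\<close>, even a compact one where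
  the curve itself cannot leave every compact set: \<open>dt\<close> is left invariant, and in a chart of
  \<open>\<Gamma>\G\<close> the projected geodesic is, near each parameter \<open>s\<close>, a left translate of the geodesic in
  the group. Its \<open>t\<close>-velocity in any chart is therefore \<open>- 2 / s\<close>, whereas an extension beyond
  \<open>s = 0\<close> would have a continuous velocity there (\<open>escaping_curve_not_extendible\<close>).

  The quotient is a manifold because a discrete subgroup is closed and acts freely and properly
  (\<open>small_neighbourhood\<close>). Everything that has to be checked in its charts reduces to one fact,
  \<open>local_lift\<close>: a chart applied to a projected continuous map \<open>f\<close> is locally \<open>y \<mapsto> a \<star> f y\<close>
  with a constant \<open>a \<in> \<Gamma>\<close>. The flow of \<open>V\<close> is translation by central elements, so it
  descends to the quotient; in charts it is locally a left translation up to a shift in \<open>z\<close>,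
  hence a smooth isometry. The transition maps are the case of time \<open>0\<close>.

  A cocompact lattice is obtained from the ring of integers of \<open>\<rat>(\<surd>5)\<close>, embedded in \<open>\<real>\<^sup>2\<close> by its
  two real embeddings: multiplication by the unit \<open>\<phi>\<^sup>2\<close>, with \<open>\<phi>\<close> the golden ratio, acts on it as
  \<open>diag(e\<^sup>\<tau>, e\<^sup>-\<^sup>\<tau>)\<close> for \<open>\<tau> = ln \<phi>\<^sup>2\<close>.
\<close>


section \<open>Smoothness is local\<close>

text \<open>The derivative is a choice among all linear maps that are derivatives of \<open>f\<close>, and these are
  the same for both functions; so the equation holds also where \<open>f\<close> has no derivative.\<close>

lemma frechet_derivative_germ:
  assumes "open N" "x \<in> N" "\<And>y. y \<in> N \<Longrightarrow> f y = g y"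
  shows "frechet_derivative f (at x) = frechet_derivative g (at x)"
proof -
  have "(f has_derivative D) (at x) \<longleftrightarrow> (g has_derivative D) (at x)" for D
    using assms has_derivative_transform_within_open[of f D x UNIV N g]
      has_derivative_transform_within_open[of g D x UNIV N f] by auto
  then show ?thesis
    by (simp add: frechet_derivative_def)
qed

text \<open>Coordinate expressions on the quotient agree with explicit affine maps only near each point,
  the map varying with the point; this lemma is what makes them smooth. The
  induction runs over all \<open>f\<close>, since the induction hypothesis is used for the directional derivatives.\<close>

lemma Ck_on_local:
  fixes f :: "'e::euclidean_space \<Rightarrow> 'f::real_normed_vector"
  assumes "open S"
    and "\<And>x. x \<in> S \<Longrightarrow> \<exists>N h. open N \<and> x \<in> N \<and> N \<subseteq> S \<and> (\<forall>y\<in>N. f y = h y) \<and> Ck_on k h N"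
  shows "Ck_on k f S"
  using assms(2)
proof (induction k arbitrary: f)
  case 0
  have "isCont f x" if x: "x \<in> S" for x
  proof -
    obtain N h where N: "open N" "x \<in> N" "\<forall>y\<in>N. f y = h y" "continuous_on N h"
      using 0[OF x] by auto
    then have "continuous_on N f" using continuous_on_cong[of N N f h] by simp
    then show ?thesis using N(1,2) continuous_on_eq_continuous_at by metis
  qed
  then show ?case
    using \<open>open S\<close> by (simp add: continuous_on_eq_continuous_at)
next
  case (Suc k)
  have "f differentiable (at x)" if x: "x \<in> S" for x
  proof -
    obtain N h where N: "open N" "x \<in> N" "\<forall>y\<in>N. f y = h y" "h differentiable_on N"
      using Suc.prems[OF x] by auto
    then have "h differentiable (at x)"
      by (metis at_within_open differentiable_on_def)
    then obtain D where "(h has_derivative D) (at x)"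
      by (auto simp: differentiable_def)
    then have "(f has_derivative D) (at x)"
      by (rule has_derivative_transform_within_open[OF _ N(1,2)]) (use N in auto)
    then show ?thesis by (auto simp: differentiable_def)
  qed
  moreover have "Ck_on k (\<lambda>x. frechet_derivative f (at x) v) S" for v
  proof (rule Suc.IH)
    fix x assume "x \<in> S"
    then obtain N h where N: "open N" "x \<in> N" "N \<subseteq> S" "\<forall>y\<in>N. f y = h y" "Ck_on (Suc k) h N"
      using Suc.prems by blast
    then have "\<forall>y\<in>N. frechet_derivative f (at y) v = frechet_derivative h (at y) v"
      using frechet_derivative_germ[of N _ f h] by metis
    then show "\<exists>N h. open N \<and> x \<in> N \<and> N \<subseteq> S \<and>
        (\<forall>y\<in>N. frechet_derivative f (at y) v = h y) \<and> Ck_on k h N"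
      using N by (intro exI[of _ N] exI[of _ "\<lambda>y. frechet_derivative h (at y) v"]) auto
  qed
  ultimately show ?case
    by (simp add: differentiable_at_imp_differentiable_on)
qed

lemma smooth_on_local:
  fixes f :: "'e::euclidean_space \<Rightarrow> 'f::real_normed_vector"
  assumes "open S"
    and "\<And>x. x \<in> S \<Longrightarrow> \<exists>N h. open N \<and> x \<in> N \<and> N \<subseteq> S \<and> (\<forall>y\<in>N. f y = h y) \<and> smooth_on N h"
  shows "smooth_on S f"
  unfolding smooth_on_def
proof
  fix k show "Ck_on k f S"
  proof (rule Ck_on_local[OF assms(1)])
    fix x assume "x \<in> S"
    then obtain N h where "open N" "x \<in> N" "N \<subseteq> S" "\<forall>y\<in>N. f y = h y" "smooth_on N h"
      using assms(2) by blast
    then show "\<exists>N h. open N \<and> x \<in> N \<and> N \<subseteq> S \<and> (\<forall>y\<in>N. f y = h y) \<and> Ck_on k h N"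
      unfolding smooth_on_def by (intro exI[of _ N] exI[of _ h]) simp
  qed
qed

lemma Ck_on_const: "Ck_on k (\<lambda>_. c) S"
  by (induction k arbitrary: c) (simp_all add: frechet_derivative_const)

lemma smooth_on_affine:
  assumes "bounded_linear L"
  shows "smooth_on S (\<lambda>x. L x + c)"
proof -
  have D: "((\<lambda>x. L x + c) has_derivative L) (at x within A)" for x A
    using assms by (auto intro!: derivative_eq_intros bounded_linear_imp_has_derivative)
  have "Ck_on k (\<lambda>x. L x + c) S" for k
  proof (cases k)
    case 0
    then show ?thesis
      using linear_continuous_on[OF assms] by (auto intro!: continuous_intros)
  next
    case (Suc j)
    have "frechet_derivative (\<lambda>x. L x + c) (at x) = L" for x
      using frechet_derivative_at[OF D] by simp
    moreover have "(\<lambda>x. L x + c) differentiable_on S"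
      using D by (auto simp: differentiable_on_def differentiable_def)
    ultimately show ?thesis
      using Suc by (simp add: Ck_on_const)
  qed
  then show ?thesis by (simp add: smooth_on_def)
qed


section \<open>The group in coordinates\<close>

abbreviation T_of :: "solR \<Rightarrow> real" where "T_of p \<equiv> fst (fst p)"
abbreviation X_of :: "solR \<Rightarrow> real" where "X_of p \<equiv> fst (snd (fst p))"
abbreviation Y_of :: "solR \<Rightarrow> real" where "Y_of p \<equiv> snd (snd (fst p))"
abbreviation Z_of :: "solR \<Rightarrow> real" where "Z_of p \<equiv> snd p"

abbreviation mul :: "solR \<Rightarrow> solR \<Rightarrow> solR" (infixl \<open>\<star>\<close> 70) where
  "a \<star> p \<equiv> a \<otimes>\<^bsub>SolR\<^esub> p"

interpretation SolR: group SolR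
  by (rule group_SolR)

lemma carrier_SolR [simp]: "carrier SolR = UNIV"
  by (auto simp: SolR_def Sol_def Radd_def DirProd_def)

lemma one_SolR: "\<one>\<^bsub>SolR\<^esub> = ((0, 0, 0), 0)"
  by (simp add: SolR_def Sol_def Radd_def DirProd_def)

lemma mult_SolR:
  "a \<star> p = ((T_of a + T_of p, X_of a + exp (T_of a) * X_of p, Y_of a + exp (- T_of a) * Y_of p),
     Z_of a + Z_of p)"
  by (simp add: SolR_def Sol_def Radd_def DirProd_def case_prod_unfold)

lemma inv_SolR:
  "inv\<^bsub>SolR\<^esub> p = ((- T_of p, - exp (- T_of p) * X_of p, - exp (T_of p) * Y_of p), - Z_of p)"
  by (rule SolR.inv_equality) (auto simp: mult_SolR one_SolR)

lemma continuous_on_mult_SolR [continuous_intros]: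
  fixes f h :: "'c::topological_space \<Rightarrow> solR"
  assumes "continuous_on S f" "continuous_on S h"
  shows "continuous_on S (\<lambda>x. f x \<star> h x)"
  unfolding mult_SolR by (intro continuous_intros assms)

lemma continuous_on_inv_SolR [continuous_intros]:
  fixes f :: "'c::topological_space \<Rightarrow> solR"
  assumes "continuous_on S f"
  shows "continuous_on S (\<lambda>x. inv\<^bsub>SolR\<^esub> (f x))"
  unfolding inv_SolR by (intro continuous_intros assms)

text \<open>Left translations are affine maps of \<open>\<real>\<^sup>4\<close>; this is their linear part.\<close>

definition translation_differential :: "solR \<Rightarrow> solR \<Rightarrow> solR" where
  "translation_differential a u =
     ((T_of u, exp (T_of a) * X_of u, exp (- T_of a) * Y_of u), Z_of u)"

lemma mult_SolR_affine: "a \<star> p = translation_differential a p + a"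
  by (simp add: mult_SolR translation_differential_def prod_eq_iff)

lemma bounded_linear_translation_differential: "bounded_linear (translation_differential a)"
  unfolding linear_conv_bounded_linear[symmetric]
  by (rule linearI) (auto simp: translation_differential_def algebra_simps)

lemma mult_SolR_has_derivative:
  "((\<lambda>q. a \<star> (q + c)) has_derivative translation_differential a) (at p within S)"
  unfolding mult_SolR translation_differential_def by (auto intro!: derivative_eq_intros)

lemma left_translate_eq: "left_translate a p = translation_differential a"
  using frechet_derivative_at[OF mult_SolR_has_derivative[of a 0 p UNIV]]
  by (simp add: left_translate_def)

lemma left_field_eq: "left_field \<xi> p = translation_differential p \<xi>"
  by (simp add: left_field_def left_translate_eq)

lemma mult_SolR_add_central: "a \<star> (p + (0, s)) = a \<star> p + (0, s)"
  by (simp add: mult_SolR prod_eq_iff)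

lemma smooth_on_mult_SolR: "smooth_on S (\<lambda>q. a \<star> (q + (0, s)))"
  using smooth_on_affine[OF bounded_linear_translation_differential, of S a "a + (0, s)"]
  unfolding mult_SolR_add_central by (simp add: mult_SolR_affine add.assoc)


section \<open>The metric\<close>

definition sol_metric :: "solR \<Rightarrow> solR \<Rightarrow> solR \<Rightarrow> real" where
  "sol_metric p u v = T_of u * T_of v + exp (2 * T_of p) * (Y_of u * Y_of v)
     + exp (- T_of p) * (X_of u * Z_of v + Z_of u * X_of v)"

text \<open>The exponential factors in the metric cancel those in the differential of a translation. The
  shift by \<open>s\<close> is the central flow, on which the coefficients do not depend; including it covers
  left translations and the flow at once.\<close>

lemma sol_metric_translate:
  "sol_metric (a \<star> p + (0, s)) (translation_differential a u) (translation_differential a v)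
     = sol_metric p u v"
proof -
  have "exp (2 * (T_of a + T_of p)) * (exp (- T_of a) * y * (exp (- T_of a) * y'))
      = exp (2 * T_of p) * (y * y')" for y y'
  proof -
    have "exp (2 * (T_of a + T_of p)) * (exp (- T_of a) * y * (exp (- T_of a) * y'))
      = (exp (2 * (T_of a + T_of p)) * exp (- T_of a) * exp (- T_of a)) * (y * y')"
      by (simp only: ac_simps)
    also have "\<dots> = exp (2 * T_of p) * (y * y')"
      by (simp add: exp_add[symmetric])
    finally show ?thesis .
  qed
  moreover have "exp (- (T_of a + T_of p)) * (exp (T_of a) * x * z + z' * (exp (T_of a) * x'))
      = exp (- T_of p) * (x * z + z' * x')" for x z x' z'
  proof -
    have "exp (- (T_of a + T_of p)) * (exp (T_of a) * x * z + z' * (exp (T_of a) * x'))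
      = (exp (- (T_of a + T_of p)) * exp (T_of a)) * (x * z + z' * x')"
      by (simp add: algebra_simps)
    also have "\<dots> = exp (- T_of p) * (x * z + z' * x')"
      by (simp add: exp_add[symmetric])
    finally show ?thesis .
  qed
  ultimately show ?thesis
    by (simp only: sol_metric_def translation_differential_def mult_SolR fst_conv snd_conv
      fst_add snd_add fst_zero snd_zero add_0_right)
qed

lemma left_invariant_sol_metric: "left_invariant_metric sol_metric"
  unfolding left_invariant_metric_def left_translate_eq
  using sol_metric_translate[of _ _ 0] by (simp add: zero_prod_def[symmetric])

lemma sol_metric_has_derivative:
  "((\<lambda>q. sol_metric q u v) has_derivative (\<lambda>w. 2 * T_of w * exp (2 * T_of p) * (Y_of u * Y_of v)
     - T_of w * exp (- T_of p) * (X_of u * Z_of v + Z_of u * X_of v))) (at p within S)"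
  unfolding sol_metric_def by (auto intro!: derivative_eq_intros simp: algebra_simps)

lemma frechet_derivative_sol_metric:
  "frechet_derivative (\<lambda>q. sol_metric q u v) (at p) = (\<lambda>w. 2 * T_of w * exp (2 * T_of p) * (Y_of u * Y_of v)
     - T_of w * exp (- T_of p) * (X_of u * Z_of v + Z_of u * X_of v))"
  by (rule frechet_derivative_at[OF sol_metric_has_derivative, symmetric])

lemma smooth_on_sol_metric: "smooth_on S (\<lambda>p. sol_metric p u v)"
proof -
  \<comment> \<open>A class of functions that contains the coefficients and is closed under differentiation.\<close>
  define F where "F A B C p = A + B * exp (2 * T_of p) + C * exp (- T_of p)" for A B C :: real and p :: solR
  have D: "(F A B C has_derivative (\<lambda>w. T_of w * F 0 (2 * B) (- C) p)) (at p within S')" for A B C p S'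
    unfolding F_def by (auto intro!: derivative_eq_intros simp: algebra_simps)
  have "Ck_on k (F A B C) S" for k A B C
  proof (induction k arbitrary: A B C)
    case 0
    show ?case unfolding F_def by (auto intro!: continuous_intros)
  next
    case (Suc k)
    have "frechet_derivative (F A B C) (at p) w = F 0 (2 * T_of w * B) (- T_of w * C) p" for p w
      by (subst frechet_derivative_at[OF D, symmetric]) (simp add: F_def algebra_simps)
    moreover have "F A B C differentiable_on S"
      unfolding differentiable_on_def differentiable_def using D by blast
    ultimately show ?case
      using Suc.IH by simp
  qed
  then have "smooth_on S (F A B C)" for A B C
    by (simp add: smooth_on_def)
  moreover have "(\<lambda>p. sol_metric p u v)
      = F (T_of u * T_of v) (Y_of u * Y_of v) (X_of u * Z_of v + Z_of u * X_of v)"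
    by (simp add: sol_metric_def F_def fun_eq_iff algebra_simps)
  ultimately show ?thesis by simp
qed

lemma bilinear_sol_metric: "bilinear (sol_metric p)"
  unfolding bilinear_def by (auto intro!: linearI simp: sol_metric_def algebra_simps)

lemma lorentz_form_sol_metric: "lorentz_form (sol_metric p)"
proof -
  define t where "t = T_of p"
  \<comment> \<open>The null vectors \<open>e\<^sup>t \<partial>\<^sub>x\<close> and \<open>\<partial>\<^sub>z\<close> have product \<open>1\<close>, so adding half of the former to the latter
    gives a vector of square \<open>1\<close>, and subtracting it an orthogonal one of square \<open>-1\<close>.\<close>
  define e0 e1 e2 e3 :: solR where e: "e0 = ((0, - exp t / 2, 0), 1)" "e1 = ((1, 0, 0), 0)"
    "e2 = ((0, 0, exp (- t)), 0)" "e3 = ((0, exp t / 2, 0), 1)"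
  let ?B = "{e0, e1, e2, e3}"
  have E: "exp (2 * t) * (exp (- t) * exp (- t)) = 1" "exp (- t) * exp t = 1"
    by (simp_all add: exp_add[symmetric])
  have g: "sol_metric p e0 e0 = -1" "sol_metric p e1 e1 = 1" "sol_metric p e2 e2 = 1"
    "sol_metric p e3 e3 = 1" "sol_metric p e0 e1 = 0" "sol_metric p e0 e2 = 0"
    "sol_metric p e0 e3 = 0" "sol_metric p e1 e2 = 0" "sol_metric p e1 e3 = 0"
    "sol_metric p e2 e3 = 0"
    using E by (simp_all add: sol_metric_def e t_def[symmetric])
  have sym: "sol_metric p u v = sol_metric p v u" for u v
    by (simp add: sol_metric_def algebra_simps)
  have "u \<in> span ?B" for u
  proof -
    have "u = (Z_of u / 2 - exp (- t) * X_of u) *\<^sub>R e0 + T_of u *\<^sub>R e1 + (exp t * Y_of u) *\<^sub>R e2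
        + (Z_of u / 2 + exp (- t) * X_of u) *\<^sub>R e3"
      using E by (simp add: e prod_eq_iff field_simps exp_minus)
    also have "\<dots> \<in> span ?B"
      by (intro span_add span_scale span_base) auto
    finally show ?thesis .
  qed
  then have span: "span ?B = UNIV" by auto
  moreover have "independent ?B"
  proof (rule card_le_dim_spanning[of _ UNIV])
    have "card ?B \<le> 4" by (simp add: card_insert_if)
    then show "card ?B \<le> dim (UNIV :: solR set)" by simp
  qed (use span in auto)
  moreover have "\<forall>u\<in>?B - {e0}. sol_metric p u u = 1"
    using g by blast
  moreover have "\<forall>u\<in>?B. \<forall>v\<in>?B. u \<noteq> v \<longrightarrow> sol_metric p u v = 0"
    using g sym[of e1 e0] sym[of e2 e0] sym[of e3 e0] sym[of e2 e1] sym[of e3 e1] sym[of e3 e2]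
    by simp
  ultimately show ?thesis
    unfolding lorentz_form_def
    using bilinear_sol_metric sym g(1) by blast
qed

text \<open>The metric is nondegenerate, so the Christoffel vector is determined by its products with
  the four coordinate directions. As \<open>\<partial>\<^sub>x\<close> and \<open>\<partial>\<^sub>z\<close> are null and pair with each other, the
  product with \<open>\<partial>\<^sub>z\<close> yields the \<open>x\<close>-component and vice versa.\<close>

lemma christoffel_sol_metric:
  "christoffel sol_metric p u v =
     ((exp (- T_of p) * (X_of u * Z_of v + Z_of u * X_of v) / 2 - exp (2 * T_of p) * (Y_of u * Y_of v),
       - (T_of u * X_of v + T_of v * X_of u) / 2, T_of u * Y_of v + T_of v * Y_of u),
      - (T_of u * Z_of v + T_of v * Z_of u) / 2)" (is "_ = ?w")
  unfolding christoffel_def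
proof (rule the_equality)
  show "\<forall>z. sol_metric p ?w z = (frechet_derivative (\<lambda>y. sol_metric y v z) (at p) u
      + frechet_derivative (\<lambda>y. sol_metric y u z) (at p) v
      - frechet_derivative (\<lambda>y. sol_metric y u v) (at p) z) / 2"
    unfolding frechet_derivative_sol_metric unfolding sol_metric_def by (simp add: field_simps)
next
  fix w
  assume w: "\<forall>z. sol_metric p w z = (frechet_derivative (\<lambda>y. sol_metric y v z) (at p) u
      + frechet_derivative (\<lambda>y. sol_metric y u z) (at p) v
      - frechet_derivative (\<lambda>y. sol_metric y u v) (at p) z) / 2"
  have "T_of w = T_of ?w"
    using w[rule_format, of "((1, 0, 0), 0)"]
    unfolding frechet_derivative_sol_metric unfolding sol_metric_def by (simp add: field_simps)
  moreover have "exp (- T_of p) * X_of w = exp (- T_of p) * X_of ?w"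
    using w[rule_format, of "((0, 0, 0), 1)"]
    unfolding frechet_derivative_sol_metric unfolding sol_metric_def by (simp add: field_simps)
  moreover have "exp (2 * T_of p) * Y_of w = exp (2 * T_of p) * Y_of ?w"
    using w[rule_format, of "((0, 0, 1), 0)"]
    unfolding frechet_derivative_sol_metric unfolding sol_metric_def by (simp add: field_simps)
  moreover have "exp (- T_of p) * Z_of w = exp (- T_of p) * Z_of ?w"
    using w[rule_format, of "((0, 1, 0), 0)"]
    unfolding frechet_derivative_sol_metric unfolding sol_metric_def by (simp add: field_simps)
  ultimately show "w = ?w"
    by (simp add: prod_eq_iff del: mult_minus_right)
qed

lemma christoffel_germ:
  assumes "open N" "x \<in> N" "\<And>y. y \<in> N \<Longrightarrow> h y = k y"
  shows "christoffel h x u v = christoffel k x u v"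
proof -
  have "frechet_derivative (\<lambda>y. h y a b) (at x) = frechet_derivative (\<lambda>y. k y a b) (at x)" for a b
    by (rule frechet_derivative_germ[OF assms(1,2)]) (simp add: assms(3))
  then show ?thesis
    by (simp add: christoffel_def assms)
qed


section \<open>The central null Killing field\<close>

definition central_field :: "solR \<Rightarrow> solR" where
  "central_field = left_field (0, 1)"

lemma central_field_eq: "central_field p = (0, 1)"
  by (simp add: central_field_def left_field_eq translation_differential_def prod_eq_iff)

text \<open>\<open>\<partial>\<^sub>z\<close> is a constant field, and left invariant fields do not change along it, because their
  components depend only on \<open>t\<close>.\<close>

lemma central_in_lie_center: "(0, 1) \<in> lie_center"
proof -
  have L: "frechet_derivative (left_field \<eta>) (at p) (0, 1) = 0" for \<eta> p
  proof -
    have "(left_field \<eta> has_derivative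
        (\<lambda>w. ((0, T_of w * exp (T_of p) * X_of \<eta>, - T_of w * exp (- T_of p) * Y_of \<eta>), 0))) (at p)"
      unfolding left_field_eq[abs_def] translation_differential_def
      by (auto intro!: derivative_eq_intros simp: zero_prod_def)
    then show ?thesis
      by (subst frechet_derivative_at[symmetric], assumption) (simp add: zero_prod_def)
  qed
  have "left_field (0, 1) = (\<lambda>_. (0, 1))"
    using central_field_eq by (auto simp: central_field_def)
  then show ?thesis
    by (simp add: lie_center_def lie_bracket_def field_bracket_def L frechet_derivative_const)
qed

lemma central_null_killing_central_field: "central_null_killing sol_metric central_field"
proof -
  have "frechet_derivative central_field (at p) = (\<lambda>_. 0)" for p
    using frechet_derivative_const[of "(0, 1) :: solR"] by (simp add: central_field_eq[abs_def])
  then have "killing_field sol_metric central_field"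
    unfolding killing_field_def frechet_derivative_sol_metric
    by (simp add: central_field_eq sol_metric_def)
  moreover have "(0, 1) \<noteq> (0 :: solR)"
    by (simp add: zero_prod_def)
  moreover have "sol_metric p (central_field p) (central_field p) = 0" for p
    by (simp add: central_field_eq sol_metric_def)
  ultimately show ?thesis
    unfolding central_null_killing_def using central_in_lie_center central_field_def by blast
qed


section \<open>The incomplete geodesic\<close>

definition escaping_curve :: "real \<Rightarrow> solR" where
  "escaping_curve s = ((- 2 * ln s, - 1 / s, 0), 2 / s)"

text \<open>The velocity of the translate of the curve by \<open>a\<close>. In the charts of a quotient only such
  translates are visible, so the geodesic equation is needed for all of them.\<close>

definition escaping_velocity :: "solR \<Rightarrow> real \<Rightarrow> solR" where
  "escaping_velocity a s = ((- 2 / s, exp (T_of a) / s\<^sup>2, 0), - 2 / s\<^sup>2)"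

lemma escaping_curve_has_velocity:
  assumes "s > 0"
  shows "((\<lambda>r. a \<star> escaping_curve r) has_vector_derivative escaping_velocity a s) (at s)"
proof -
  have "((\<lambda>r. T_of a - 2 * ln r) has_real_derivative - 2 / s) (at s)"
    "((\<lambda>r. X_of a - exp (T_of a) / r) has_real_derivative exp (T_of a) / s\<^sup>2) (at s)"
    "((\<lambda>r. Z_of a + 2 / r) has_real_derivative - 2 / s\<^sup>2) (at s)"
    using assms by (auto intro!: derivative_eq_intros simp: power2_eq_square)
  then show ?thesis
    unfolding mult_SolR escaping_curve_def escaping_velocity_def
    by (simp add: has_real_derivative_iff_has_vector_derivative has_vector_derivative_Pair)
qed

lemma escaping_velocity_geodesic:
  assumes "s > 0"
  shows "(escaping_velocity a has_vector_derivative
     - christoffel sol_metric (a \<star> escaping_curve s) (escaping_velocity a s) (escaping_velocity a s)) (at s)"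
proof -
  define A where "A = exp (T_of a)"
  have "exp (2 * ln s) = s\<^sup>2"
    using assms by (simp add: exp_double)
  then have E: "exp (- T_of (a \<star> escaping_curve s)) = s\<^sup>2 / A"
    by (simp add: mult_SolR escaping_curve_def A_def exp_diff)
  have v: "escaping_velocity a s = ((- 2 / s, A / s\<^sup>2, 0), - 2 / s\<^sup>2)"
    by (simp add: escaping_velocity_def A_def)
  have "A > 0" by (simp add: A_def)
  have "- christoffel sol_metric (a \<star> escaping_curve s) (escaping_velocity a s) (escaping_velocity a s)
      = ((2 / s\<^sup>2, - 2 * A / s ^ 3, 0), 4 / s ^ 3)"
    using assms \<open>A > 0\<close> unfolding christoffel_sol_metric E v
    by (simp add: power2_eq_square power3_eq_cube)
  moreover have "(escaping_velocity a has_vector_derivative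
      ((2 / s\<^sup>2, - 2 * A / s ^ 3, 0), 4 / s ^ 3)) (at s)"
  proof -
    have "((\<lambda>r. - 2 / r) has_real_derivative 2 / s\<^sup>2) (at s)"
      "((\<lambda>r. exp (T_of a) / r\<^sup>2) has_real_derivative - 2 * exp (T_of a) / s ^ 3) (at s)"
      "((\<lambda>r. - 2 / r\<^sup>2) has_real_derivative 4 / s ^ 3) (at s)"
      using assms
      by (auto intro!: derivative_eq_intros simp: power2_eq_square power3_eq_cube mult_ac)
    then show ?thesis
      unfolding escaping_velocity_def A_def
      by (simp add: has_real_derivative_iff_has_vector_derivative has_vector_derivative_Pair)
  qed
  ultimately show ?thesis by simp
qed

lemma continuous_on_escaping_curve: "continuous_on {0<..} escaping_curve"
  unfolding escaping_curve_def by (auto intro!: continuous_intros)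

text \<open>The obstruction to extending beyond \<open>0\<close>, in a form that applies to the group and to a
  chart of a quotient. The element \<open>a\<close> may depend on the parameter \<open>s\<close>: the \<open>t\<close>-component of the
  velocity is \<open>- 2 / s\<close> for every \<open>a\<close>, so no monodromy has to be controlled as \<open>s\<close> tends to \<open>0\<close>.\<close>

lemma escaping_curve_not_extendible:
  fixes c v :: "real \<Rightarrow> solR"
  assumes c: "\<forall>\<^sub>F s in nhds 0. (c has_vector_derivative v s) (at s)"
    and v: "(v has_vector_derivative w) (at 0)"
    and escape: "\<forall>\<^sub>F s in at_right 0. \<exists>a. \<forall>\<^sub>F r in nhds s. c r = a \<star> escaping_curve r"
  shows False
proof -
  have "\<forall>\<^sub>F s in at_right 0. (c has_vector_derivative v s) (at s)"
    using c at_within_le_nhds by (rule filter_leD[rotated])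
  \<comment> \<open>The product tends to \<open>- 2\<close> by this, but to \<open>0\<close> by continuity of \<open>v\<close>.\<close>
  then have "\<forall>\<^sub>F s in at_right 0. s * T_of (v s) = - 2"
    using escape eventually_at_right_less[of "0::real"]
  proof eventually_elim
    case (elim s)
    then obtain a where "\<forall>\<^sub>F r in nhds s. c r = a \<star> escaping_curve r" by blast
    then obtain N where N: "open N" "s \<in> N" "\<forall>r\<in>N. c r = a \<star> escaping_curve r"
      by (auto simp: eventually_nhds)
    have "((\<lambda>r. a \<star> escaping_curve r) has_vector_derivative v s) (at s)"
      by (rule has_vector_derivative_transform_within_open[OF elim(1) N(1,2)]) (use N in auto)
    then have "v s = escaping_velocity a s"
      using escaping_curve_has_velocity[OF elim(3)] by (rule vector_derivative_unique_at)
    then show ?case using elim(3) by (simp add: escaping_velocity_def)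
  qed
  then have "((\<lambda>s. s * T_of (v s)) \<longlongrightarrow> - 2) (at_right 0)"
    by (rule tendsto_eventually)
  moreover have "isCont v 0"
    using v by (rule has_vector_derivative_continuous)
  then have "(v \<longlongrightarrow> v 0) (at_right 0)"
    unfolding isCont_def by (rule tendsto_within_subset) simp
  then have "((\<lambda>s. s * T_of (v s)) \<longlongrightarrow> 0 * T_of (v 0)) (at_right 0)"
    by (intro tendsto_intros)
  ultimately show False
    using tendsto_unique[of "at_right (0::real)"] by fastforce
qed


section \<open>Local structure of the quotient\<close>

text \<open>The flow of the central field moves every point along \<open>\<partial>\<^sub>z\<close>; since this is a translation by a
  central element, it maps cosets to cosets.\<close>

definition central_flow :: "real \<Rightarrow> solR set \<Rightarrow> solR set" where
  "central_flow s q = (\<lambda>p. p + (0, s)) ` q"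

lemma central_flow_proj: "central_flow s (proj \<Gamma> p) = proj \<Gamma> (p + (0, s))"
  by (auto simp: central_flow_def r_coset_def mult_SolR_add_central)

lemma central_flow_0: "central_flow 0 q = q"
  by (simp add: central_flow_def zero_prod_def[symmetric])

lemma central_flow_add: "central_flow (s + t) q = central_flow s (central_flow t q)"
  by (auto simp: central_flow_def image_image add.assoc add.commute[of t])

lemma second_countable_euclidean: "second_countable (euclidean :: 'a::second_countable_topology topology)"
proof -
  obtain B :: "'a set set" where "countable B" "\<And>C. C \<in> B \<Longrightarrow> open C"
      "\<And>S. open S \<Longrightarrow> \<exists>U. U \<subseteq> B \<and> S = \<Union>U"
    using univ_second_countable by blast
  then show ?thesis
    unfolding second_countable_def open_openin[symmetric]
    by (intro exI[of _ B]) (metis UnionE Union_upper subsetD)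
qed

locale discrete_subgroup =
  fixes \<Gamma> :: "solR set"
  assumes subgroup: "subgroup \<Gamma> SolR" and discrete: "discrete \<Gamma>"
begin

abbreviation \<pi> :: "solR \<Rightarrow> solR set" where "\<pi> \<equiv> proj \<Gamma>"
abbreviation Q :: "solR set topology" where "Q \<equiv> quotient_top \<Gamma>"

abbreviation section_chart :: "solR set \<Rightarrow> (solR set, solR) chart" where
  "section_chart U \<equiv> (\<pi> ` U, inv_into U \<pi>)"

lemma proj_eq_iff: "\<pi> p = \<pi> q \<longleftrightarrow> (\<exists>a\<in>\<Gamma>. q = a \<star> p)"
proof
  assume "\<pi> p = \<pi> q"
  moreover have "q \<in> \<pi> q"
    using SolR.rcos_self[of q \<Gamma>] subgroup by simp
  ultimately show "\<exists>a\<in>\<Gamma>. q = a \<star> p"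
    by (auto simp: r_coset_def)
next
  assume "\<exists>a\<in>\<Gamma>. q = a \<star> p"
  then have "q \<in> \<pi> p" by (auto simp: r_coset_def)
  then show "\<pi> p = \<pi> q"
    using SolR.repr_independence[of q \<Gamma> p] subgroup by simp
qed

lemma proj_mult: "a \<in> \<Gamma> \<Longrightarrow> \<pi> (a \<star> p) = \<pi> p"
  using proj_eq_iff by metis

lemma rcosets_eq: "rcosets\<^bsub>SolR\<^esub> \<Gamma> = range \<pi>"
  by (auto simp: RCOSETS_def)

lemma topspace_Q: "topspace Q = range \<pi>"
proof -
  have "\<pi> -` range \<pi> = UNIV" by auto
  then have "openin Q (range \<pi>)"
    by (simp only: openin_quotient_top rcosets_eq open_UNIV subset_refl)
  then have "range \<pi> \<subseteq> topspace Q"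
    by (rule openin_subset)
  moreover have "topspace Q \<subseteq> range \<pi>"
    using openin_topspace[of Q] unfolding openin_quotient_top rcosets_eq by blast
  ultimately show ?thesis by blast
qed

lemma openin_proj_image:
  assumes "open U"
  shows "openin Q (\<pi> ` U)"
proof -
  have "\<pi> -` (\<pi> ` U) = (\<Union>a\<in>\<Gamma>. (\<lambda>x. a \<star> x) -` U)"
  proof (intro equalityI subsetI)
    fix x assume "x \<in> \<pi> -` (\<pi> ` U)"
    then obtain y where "y \<in> U" "\<pi> x = \<pi> y" by auto
    then show "x \<in> (\<Union>a\<in>\<Gamma>. (\<lambda>x. a \<star> x) -` U)"
      using proj_eq_iff[of x y] by auto
  next
    fix x assume "x \<in> (\<Union>a\<in>\<Gamma>. (\<lambda>x. a \<star> x) -` U)"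
    then obtain a where "a \<in> \<Gamma>" "a \<star> x \<in> U" by auto
    then show "x \<in> \<pi> -` (\<pi> ` U)"
      using proj_mult[of a x] by (metis imageI vimageI)
  qed
  moreover have "open ((\<lambda>x. a \<star> x) -` U)" for a
    using assms by (intro open_vimage continuous_intros)
  ultimately show ?thesis
    by (auto simp: openin_quotient_top rcosets_eq)
qed

lemma continuous_map_proj: "continuous_map euclidean Q \<pi>"
  by (auto simp: continuous_map_def topspace_Q openin_quotient_top vimage_def)

lemma open_map_proj: "open_map euclidean Q \<pi>"
  by (simp add: open_map_def openin_proj_image)

text \<open>Discreteness at the identity, transported to any point \<open>p\<close> by continuity of \<open>(x, y) \<mapsto> y x\<inverse>\<close>.
  It gives local injectivity of the projection and closedness of \<open>\<Gamma>\<close>.\<close>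

lemma small_neighbourhood:
  obtains N where "open N" "p \<in> N" "\<And>x y. x \<in> N \<Longrightarrow> y \<in> N \<Longrightarrow> y \<otimes>\<^bsub>SolR\<^esub> inv\<^bsub>SolR\<^esub> x \<in> \<Gamma> \<Longrightarrow> x = y"
proof -
  have "\<one>\<^bsub>SolR\<^esub> \<in> \<Gamma>"
    using subgroup by (rule subgroup.one_closed)
  then obtain W where W: "open W" "W \<inter> \<Gamma> = {\<one>\<^bsub>SolR\<^esub>}"
    using discrete isolated_inE unfolding discrete_def by metis
  let ?d = "\<lambda>z. snd z \<star> inv\<^bsub>SolR\<^esub> (fst z)"
  have "open (?d -` W)"
    using W(1) by (intro open_vimage continuous_intros)
  moreover have "(p, p) \<in> ?d -` W"
    using W(2) SolR.r_inv[of p] by auto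
  ultimately obtain A B where AB: "open A" "open B" "(p, p) \<in> A \<times> B" "A \<times> B \<subseteq> ?d -` W"
    by (rule open_prod_elim)
  show ?thesis
  proof (rule that[of "A \<inter> B"])
    fix x y assume "x \<in> A \<inter> B" "y \<in> A \<inter> B" "y \<star> inv\<^bsub>SolR\<^esub> x \<in> \<Gamma>"
    then have "y \<star> inv\<^bsub>SolR\<^esub> x \<in> W \<inter> \<Gamma>"
      using AB(4) by auto
    then have "y \<star> inv\<^bsub>SolR\<^esub> x = \<one>\<^bsub>SolR\<^esub>"
      using W(2) by auto
    then show "x = y"
      using SolR.inv_solve_right'[of "\<one>\<^bsub>SolR\<^esub>" y x] by simp
  qed (use AB in auto)
qed

lemma locally_injective:
  obtains U where "open U" "p \<in> U" "inj_on \<pi> U"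
proof -
  obtain N where N: "open N" "p \<in> N"
      "\<And>x y. x \<in> N \<Longrightarrow> y \<in> N \<Longrightarrow> y \<otimes>\<^bsub>SolR\<^esub> inv\<^bsub>SolR\<^esub> x \<in> \<Gamma> \<Longrightarrow> x = y"
    using small_neighbourhood by blast
  have "inj_on \<pi> N"
  proof (rule inj_onI)
    fix x y assume xy: "x \<in> N" "y \<in> N" "\<pi> x = \<pi> y"
    then obtain a where "a \<in> \<Gamma>" "y = a \<star> x" using proj_eq_iff by blast
    then have "y \<star> inv\<^bsub>SolR\<^esub> x \<in> \<Gamma>" by (simp add: SolR.m_assoc)
    then show "x = y" using N(3) xy by blast
  qed
  then show ?thesis using that N by blast
qed

text \<open>A neighbourhood as above contains at most one element of \<open>\<Gamma>\<close>, which can be removed from it.\<close>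

lemma closed_subgroup: "closed \<Gamma>"
proof -
  have "\<exists>T. open T \<and> x \<in> T \<and> T \<subseteq> - \<Gamma>" if x: "x \<notin> \<Gamma>" for x
  proof -
    obtain N where N: "open N" "x \<in> N"
        "\<And>x y. x \<in> N \<Longrightarrow> y \<in> N \<Longrightarrow> y \<otimes>\<^bsub>SolR\<^esub> inv\<^bsub>SolR\<^esub> x \<in> \<Gamma> \<Longrightarrow> x = y"
      using small_neighbourhood by blast
    show ?thesis
    proof (cases "N \<inter> \<Gamma> = {}")
      case True
      then show ?thesis using N by blast
    next
      case False
      then obtain b where b: "b \<in> N" "b \<in> \<Gamma>" by blast
      have "a = b" if "a \<in> N" "a \<in> \<Gamma>" for a
        using N(3)[OF b(1) that(1)] that b subgroup
        by (simp add: subgroup.m_closed subgroup.m_inv_closed)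
      then have "N - {b} \<subseteq> - \<Gamma>" by blast
      moreover have "open (N - {b})" "x \<in> N - {b}"
        using N b x by auto
      ultimately show ?thesis by blast
    qed
  qed
  then show ?thesis
    unfolding closed_def by (subst open_subopen) blast
qed

text \<open>Two points \<open>x\<close> and \<open>y\<close> lie in the same coset iff \<open>y x\<inverse> \<in> \<Gamma>\<close>. As \<open>\<Gamma>\<close> is closed, the pairs in
  different cosets form an open set, and the projection maps the sides of a box in it to disjoint
  open sets.\<close>

lemma Hausdorff_Q: "Hausdorff_space Q"
  unfolding Hausdorff_space_def
proof (intro allI impI)
  fix x y assume "x \<in> topspace Q \<and> y \<in> topspace Q \<and> x \<noteq> y"
  then obtain p q where pq: "x = \<pi> p" "y = \<pi> q" "\<pi> p \<noteq> \<pi> q"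
    unfolding topspace_Q by blast
  let ?d = "\<lambda>z. snd z \<star> inv\<^bsub>SolR\<^esub> (fst z)"
  have d: "?d (u, v) \<in> \<Gamma> \<longleftrightarrow> \<pi> u = \<pi> v" for u v
  proof
    assume "?d (u, v) \<in> \<Gamma>"
    moreover have "v = ?d (u, v) \<star> u" by (simp add: SolR.m_assoc)
    ultimately show "\<pi> u = \<pi> v" using proj_eq_iff by blast
  next
    assume "\<pi> u = \<pi> v"
    then obtain a where "a \<in> \<Gamma>" "v = a \<star> u" using proj_eq_iff by blast
    then show "?d (u, v) \<in> \<Gamma>" by (simp add: SolR.m_assoc)
  qed
  have "open (?d -` (- \<Gamma>))"
    using closed_subgroup by (intro open_vimage continuous_intros) auto
  moreover have "(p, q) \<in> ?d -` (- \<Gamma>)"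
    using d pq by blast
  ultimately obtain A B where AB: "open A" "open B" "(p, q) \<in> A \<times> B" "A \<times> B \<subseteq> ?d -` (- \<Gamma>)"
    by (rule open_prod_elim)
  have "disjnt (\<pi> ` A) (\<pi> ` B)"
  proof (unfold disjnt_iff, intro allI notI)
    fix r assume "r \<in> \<pi> ` A \<and> r \<in> \<pi> ` B"
    then obtain u v where "u \<in> A" "v \<in> B" "\<pi> u = \<pi> v" by blast
    then show False using AB(4) d[of u v] by blast
  qed
  then show "\<exists>U V. openin Q U \<and> openin Q V \<and> x \<in> U \<and> y \<in> V \<and> disjnt U V"
    using AB pq openin_proj_image by (intro exI[of _ "\<pi> ` A"] exI[of _ "\<pi> ` B"]) auto
qed

lemma second_countable_Q: "second_countable Q"
  using second_countable_open_map_image[OF continuous_map_proj open_map_proj]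
  by (simp add: topspace_Q second_countable_euclidean)

lemma atlas_iff:
  "c \<in> atlas (quotient_manifold \<Gamma>) \<longleftrightarrow> (\<exists>U. open U \<and> inj_on \<pi> U \<and> c = section_chart U)"
  by (auto simp: quotient_manifold_def)

lemma top_of_quotient: "top_of (quotient_manifold \<Gamma>) = Q"
  by (simp add: quotient_manifold_def)

lemma chart_inv_section:
  assumes "inj_on \<pi> U" "x \<in> U"
  shows "chart_inv (section_chart U) x = \<pi> x"
proof -
  have "inj_on (inv_into U \<pi>) (\<pi> ` U)" by (rule inj_on_inv_into) simp
  then show ?thesis
    using inv_into_f_f[of "inv_into U \<pi>" "\<pi> ` U" "\<pi> x"] assms by simp
qed

lemma is_chart_section:
  assumes U: "open U" "inj_on \<pi> U"
  shows "is_chart Q (section_chart U)"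
proof -
  have "continuous_map (subtopology Q (\<pi> ` U)) (top_of_set U) (inv_into U \<pi>)"
    unfolding continuous_map_def
  proof (intro conjI allI impI)
    fix V assume "openin (top_of_set U) V"
    then have V: "open V" "V \<subseteq> U" using U(1) by (auto simp: openin_open_eq)
    have "{q \<in> topspace (subtopology Q (\<pi> ` U)). inv_into U \<pi> q \<in> V} = \<pi> ` V"
      using V U(2) by (auto simp: topspace_Q)
    moreover have "openin (subtopology Q (\<pi> ` U)) (\<pi> ` V)"
      using openin_proj_image[OF V(1)] V(2) unfolding openin_subtopology by blast
    ultimately show "openin (subtopology Q (\<pi> ` U)) {q \<in> topspace (subtopology Q (\<pi> ` U)). inv_into U \<pi> q \<in> V}"
      by simp
  qed (use U in auto)
  moreover have "continuous_map (top_of_set U) (subtopology Q (\<pi> ` U)) \<pi>"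
    using continuous_map_proj
    by (auto simp: continuous_map_in_subtopology intro: continuous_map_from_subtopology)
  ultimately have "homeomorphic_maps (subtopology Q (\<pi> ` U)) (top_of_set U) (inv_into U \<pi>) \<pi>"
    using U(2) by (auto simp: homeomorphic_maps_def)
  then show ?thesis
    unfolding is_chart_def using U openin_proj_image
    by (auto simp: homeomorphic_map_maps)
qed

text \<open>If \<open>\<pi> (f x)\<close> lies in the chart, then \<open>a \<star> f x \<in> W\<close> for some \<open>a \<in> \<Gamma>\<close>. By continuity \<open>a \<star> f y\<close>
  stays in \<open>W\<close> for \<open>y\<close> near \<open>x\<close>, and there it is the only point of \<open>W\<close> over \<open>\<pi> (f y)\<close>.\<close>

lemma local_lift:
  fixes f :: "'c::topological_space \<Rightarrow> solR"
  assumes W: "open W" "inj_on \<pi> W"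
    and f: "open D" "continuous_on D f" "x \<in> D" "\<pi> (f x) \<in> \<pi> ` W"
  obtains a N where "a \<in> \<Gamma>" "open N" "x \<in> N" "N \<subseteq> D"
    "\<And>y. y \<in> N \<Longrightarrow> \<pi> (f y) \<in> \<pi> ` W \<and> inv_into W \<pi> (\<pi> (f y)) = a \<star> f y"
proof -
  obtain a where a: "a \<in> \<Gamma>" "a \<star> f x \<in> W"
    using f(4) proj_eq_iff by (metis imageE)
  let ?N = "(\<lambda>y. a \<star> f y) -` W \<inter> D"
  have "continuous_on D (\<lambda>y. a \<star> f y)"
    using f(2) by (intro continuous_intros)
  then have "open ?N"
    using W(1) continuous_on_open_vimage[OF f(1)] by blast
  moreover have "\<pi> (f y) \<in> \<pi> ` W \<and> inv_into W \<pi> (\<pi> (f y)) = a \<star> f y" if "y \<in> ?N" for y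
    using that inv_into_f_f[OF W(2), of "a \<star> f y"] proj_mult[OF a(1)]
    by (metis IntD1 imageI vimageE)
  ultimately show ?thesis
    using that[of a ?N] a f(3) by blast
qed

lemma flow_in_charts:
  assumes U: "open U" "inj_on \<pi> U" and W: "open W" "inj_on \<pi> W"
    and x: "x \<in> U" "central_flow s (\<pi> x) \<in> \<pi> ` W"
  obtains a N where "a \<in> \<Gamma>" "open N" "x \<in> N" "N \<subseteq> U"
    "\<And>y. y \<in> N \<Longrightarrow> central_flow s (\<pi> y) \<in> \<pi> ` W"
    "\<And>y. y \<in> N \<Longrightarrow> (snd (section_chart W) \<circ> central_flow s \<circ> chart_inv (section_chart U)) y = a \<star> (y + (0, s))"
proof -
  have cont: "continuous_on U (\<lambda>y. y + (0, s) :: solR)"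
    by (intro continuous_intros)
  have "\<pi> (x + (0, s)) \<in> \<pi> ` W"
    using x by (simp add: central_flow_proj)
  then obtain a N where N: "a \<in> \<Gamma>" "open N" "x \<in> N" "N \<subseteq> U"
      "\<And>y. y \<in> N \<Longrightarrow> \<pi> (y + (0, s)) \<in> \<pi> ` W \<and> inv_into W \<pi> (\<pi> (y + (0, s))) = a \<star> (y + (0, s))"
    by (rule local_lift[OF W U(1) cont x(1)]) (rule that)
  show ?thesis
    by (rule that[OF N(1-4)]) (use N(4,5) chart_inv_section[OF U(2)] in \<open>auto simp: central_flow_proj\<close>)
qed

lemma smooth_flow_in_charts:
  assumes c: "c \<in> atlas (quotient_manifold \<Gamma>)" and d: "d \<in> atlas (quotient_manifold \<Gamma>)"
  shows "smooth_on (snd c ` {p \<in> fst c. central_flow s p \<in> fst d}) (snd d \<circ> central_flow s \<circ> chart_inv c)"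
proof -
  obtain U where U: "open U" "inj_on \<pi> U" and c: "c = section_chart U" using c atlas_iff by auto
  obtain W where W: "open W" "inj_on \<pi> W" and d: "d = section_chart W" using d atlas_iff by auto
  let ?S = "{x \<in> U. central_flow s (\<pi> x) \<in> \<pi> ` W}"
  have "{p \<in> fst c. central_flow s p \<in> fst d} = \<pi> ` ?S"
    unfolding c d fst_conv by blast
  then have S: "snd c ` {p \<in> fst c. central_flow s p \<in> fst d} = ?S"
    using inv_into_image_cancel[OF U(2), of ?S] by (simp add: c)
  have loc: "\<exists>N h. open N \<and> x \<in> N \<and> N \<subseteq> ?S \<and>
      (\<forall>y\<in>N. (snd d \<circ> central_flow s \<circ> chart_inv c) y = h y) \<and> smooth_on N h" if "x \<in> ?S" for x
  proof -
    have x: "x \<in> U" "central_flow s (\<pi> x) \<in> \<pi> ` W"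
      using that by auto
    obtain a N where "a \<in> \<Gamma>" "open N" "x \<in> N" "N \<subseteq> U"
      "\<And>y. y \<in> N \<Longrightarrow> central_flow s (\<pi> y) \<in> \<pi> ` W"
      "\<And>y. y \<in> N \<Longrightarrow> (snd (section_chart W) \<circ> central_flow s \<circ> chart_inv (section_chart U)) y = a \<star> (y + (0, s))"
      by (rule flow_in_charts[OF U W x]) (rule that)
    then show ?thesis
      by (intro exI[of _ N] exI[of _ "\<lambda>y. a \<star> (y + (0, s))"])
        (auto simp: c d smooth_on_mult_SolR)
  qed
  have "?S = U \<inter> (\<lambda>x. x + (0, s)) -` (\<pi> -` (\<pi> ` W))"
    by (simp only: central_flow_proj vimage_def Int_def mem_Collect_eq)
  moreover have "open (\<pi> -` (\<pi> ` W))"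
    using openin_proj_image[OF W(1)] openin_quotient_top by blast
  ultimately have "open ?S"
    using U(1) by (auto intro!: open_Int open_vimage continuous_intros)
  then show ?thesis
    unfolding S using loc by (rule smooth_on_local)
qed

text \<open>Both parts hold because the coordinate expression of the flow has the same derivative as a
  left translation, which preserves the metric and the central vector. The second part for time
  \<open>0\<close> is the transformation rule of the vector field under changes of charts.\<close>

lemma flow_preserves_metric:
  assumes c: "c \<in> atlas (quotient_manifold \<Gamma>)" and d: "d \<in> atlas (quotient_manifold \<Gamma>)"
    and p: "p \<in> fst c" "central_flow s p \<in> fst d"
  shows "quotient_metric sol_metric d (central_flow s p)
       (frechet_derivative (snd d \<circ> central_flow s \<circ> chart_inv c) (at (snd c p)) u)
       (frechet_derivative (snd d \<circ> central_flow s \<circ> chart_inv c) (at (snd c p)) v)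
     = quotient_metric sol_metric c p u v" (is ?metric)
    and "frechet_derivative (snd d \<circ> central_flow s \<circ> chart_inv c) (at (snd c p)) (0, 1) = (0, 1)" (is ?field)
proof -
  obtain U where U: "open U" "inj_on \<pi> U" and c: "c = section_chart U" using c atlas_iff by auto
  obtain W where W: "open W" "inj_on \<pi> W" and d: "d = section_chart W" using d atlas_iff by auto
  obtain x where x: "x \<in> U" "p = \<pi> x" using p by (auto simp: c)
  have cp: "snd c p = x" using U x by (simp add: c)
  let ?f = "snd d \<circ> central_flow s \<circ> chart_inv c"
  have "central_flow s (\<pi> x) \<in> \<pi> ` W" using p(2) by (simp add: d x(2))
  then obtain a N where "a \<in> \<Gamma>" and N: "open N" "x \<in> N" "N \<subseteq> U"
      "\<And>y. y \<in> N \<Longrightarrow> central_flow s (\<pi> y) \<in> \<pi> ` W"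
      "\<And>y. y \<in> N \<Longrightarrow> (snd (section_chart W) \<circ> central_flow s \<circ> chart_inv (section_chart U)) y = a \<star> (y + (0, s))"
    by (rule flow_in_charts[OF U W x(1)]) (rule that)
  have f: "?f y = a \<star> (y + (0, s))" if "y \<in> N" for y
    unfolding c d using that by (rule N(5))
  have "frechet_derivative ?f (at x) = frechet_derivative (\<lambda>q. a \<star> (q + (0, s))) (at x)"
    by (rule frechet_derivative_germ[OF N(1,2)]) (rule f)
  also have "\<dots> = translation_differential a"
    by (rule frechet_derivative_at[OF mult_SolR_has_derivative, symmetric])
  finally have D: "frechet_derivative ?f (at x) = translation_differential a" .
  have "snd d (central_flow s p) = a \<star> x + (0, s)"
    using f[OF N(2)] chart_inv_section[OF U(2) x(1)] by (simp add: c x(2) mult_SolR_add_central)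
  then show ?metric
    unfolding cp D quotient_metric_def by (simp add: sol_metric_translate)
  show ?field
    unfolding cp D by (simp add: translation_differential_def prod_eq_iff)
qed

lemma transition_eq_flow: "transition c d = snd d \<circ> central_flow 0 \<circ> chart_inv c"
  by (simp add: transition_def fun_eq_iff central_flow_0)

lemma smooth_manifold_quotient: "smooth_manifold (quotient_manifold \<Gamma>)"
proof -
  have "(\<Union>c\<in>atlas (quotient_manifold \<Gamma>). fst c) = range \<pi>"
  proof (intro equalityI subsetI)
    fix q assume "q \<in> range \<pi>"
    then obtain p where "q = \<pi> p" by blast
    moreover obtain U where "open U" "p \<in> U" "inj_on \<pi> U" by (rule locally_injective)
    ultimately have "section_chart U \<in> atlas (quotient_manifold \<Gamma>)" "q \<in> fst (section_chart U)"
      using atlas_iff by auto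
    then show "q \<in> (\<Union>c\<in>atlas (quotient_manifold \<Gamma>). fst c)" by blast
  qed (auto simp: atlas_iff)
  moreover have "smooth_on (snd c ` (fst c \<inter> fst d)) (transition c d)"
    if "c \<in> atlas (quotient_manifold \<Gamma>)" "d \<in> atlas (quotient_manifold \<Gamma>)" for c d
  proof -
    have "fst c \<inter> fst d = {p \<in> fst c. central_flow 0 p \<in> fst d}" by (auto simp: central_flow_0)
    then show ?thesis
      using smooth_flow_in_charts[OF that, of 0] by (simp only: transition_eq_flow)
  qed
  moreover have "is_chart Q c" if "c \<in> atlas (quotient_manifold \<Gamma>)" for c
    using that atlas_iff is_chart_section by auto
  ultimately show ?thesis
    unfolding smooth_manifold_def top_of_quotient
    by (simp add: Hausdorff_Q second_countable_Q topspace_Q)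
qed

lemma snd_chart_inv:
  assumes "inj_on \<pi> U" "x \<in> U"
  shows "inv_into U \<pi> (chart_inv (section_chart U) x) = x"
  using chart_inv_section[OF assms] assms by simp

lemma lorentzian_quotient: "lorentzian_manifold (quotient_manifold \<Gamma>) (quotient_metric sol_metric)"
  unfolding lorentzian_manifold_def
proof (intro conjI ballI allI)
  fix c u v assume "c \<in> atlas (quotient_manifold \<Gamma>)"
  then obtain U where U: "open U" "inj_on \<pi> U" and c: "c = section_chart U" using atlas_iff by auto
  have "\<forall>x\<in>U. quotient_metric sol_metric c (chart_inv c x) u v = sol_metric x u v"
    using snd_chart_inv[OF U(2)] by (simp add: quotient_metric_def c)
  then have "smooth_on U (\<lambda>x. quotient_metric sol_metric c (chart_inv c x) u v)"
    using U(1) smooth_on_sol_metric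
    by (intro smooth_on_local[OF U(1)] exI[of _ U] exI[of _ "\<lambda>x. sol_metric x u v"]) auto
  then show "smooth_on (snd c ` fst c) (\<lambda>x. quotient_metric sol_metric c (chart_inv c x) u v)"
    using U(2) by (simp add: c)
next
  fix c d p u v
  assume "c \<in> atlas (quotient_manifold \<Gamma>)" "d \<in> atlas (quotient_manifold \<Gamma>)" "p \<in> fst c \<inter> fst d"
  then show "quotient_metric sol_metric d p (frechet_derivative (transition c d) (at (snd c p)) u)
      (frechet_derivative (transition c d) (at (snd c p)) v) = quotient_metric sol_metric c p u v"
    using flow_preserves_metric(1)[of c d p 0 u v] by (simp add: transition_eq_flow central_flow_0 del: o_apply)
qed (simp_all add: smooth_manifold_quotient quotient_metric_def lorentz_form_sol_metric)

lemma smooth_vector_field_quotient: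
  "smooth_vector_field (quotient_manifold \<Gamma>) (quotient_field central_field)"
  unfolding smooth_vector_field_def
proof (intro conjI ballI)
  fix c d p
  assume "c \<in> atlas (quotient_manifold \<Gamma>)" "d \<in> atlas (quotient_manifold \<Gamma>)" "p \<in> fst c \<inter> fst d"
  then show "quotient_field central_field d p
      = frechet_derivative (transition c d) (at (snd c p)) (quotient_field central_field c p)"
    using flow_preserves_metric(2)[of c d p 0]
    by (simp add: quotient_field_def central_field_eq transition_eq_flow central_flow_0 del: o_apply)
qed (simp add: quotient_field_def central_field_eq smooth_on_def Ck_on_const)

lemma continuous_map_central_flow: "continuous_map Q Q (central_flow s)"
  unfolding continuous_map_def
proof (intro conjI allI impI)
  fix V assume V: "openin Q V"
  have "\<pi> -` {q \<in> topspace Q. central_flow s q \<in> V} = (\<lambda>p. p + (0, s)) -` (\<pi> -` V)"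
    by (auto simp: topspace_Q central_flow_proj)
  moreover have "open \<dots>"
    using V by (intro open_vimage continuous_intros) (simp add: openin_quotient_top)
  ultimately show "openin Q {q \<in> topspace Q. central_flow s q \<in> V}"
    unfolding openin_quotient_top by (auto simp: topspace_Q rcosets_eq)
qed (auto simp: topspace_Q central_flow_proj)

lemma isometry_central_flow:
  "isometry (quotient_manifold \<Gamma>) (quotient_metric sol_metric) (central_flow s)"
proof -
  have smooth: "smooth_map (quotient_manifold \<Gamma>) (quotient_manifold \<Gamma>) (central_flow r)" for r
    unfolding smooth_map_def top_of_quotient
    using continuous_map_central_flow smooth_flow_in_charts by blast
  have "central_flow (- s) (central_flow s q) = q" "central_flow s (central_flow (- s) q) = q" for q
    using central_flow_add[of "- s" s q] central_flow_add[of s "- s" q] by (simp_all add: central_flow_0)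
  then have "diffeomorphism (quotient_manifold \<Gamma>) (quotient_manifold \<Gamma>) (central_flow s)"
    unfolding diffeomorphism_def using smooth by blast
  then show ?thesis
    unfolding isometry_def using flow_preserves_metric(1) by blast
qed

lemma is_flow_central_flow:
  "is_flow (quotient_manifold \<Gamma>) (quotient_field central_field) central_flow"
  unfolding is_flow_def
proof (intro ballI conjI allI)
  fix q assume "q \<in> points (quotient_manifold \<Gamma>)"
  then obtain p where q: "q = \<pi> p" by (auto simp: top_of_quotient topspace_Q)
  have curve: "(\<lambda>t. central_flow t q) = \<pi> \<circ> (\<lambda>t. p + (0, t))"
    by (simp add: fun_eq_iff q central_flow_proj)
  have cont: "continuous_on UNIV (\<lambda>t. p + (0, t))"
    by (intro continuous_intros)
  show "integral_curve (quotient_manifold \<Gamma>) (quotient_field central_field) (\<lambda>t. central_flow t q)"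
    unfolding integral_curve_def
  proof (intro conjI ballI allI impI)
    show "continuous_map euclidean (top_of (quotient_manifold \<Gamma>)) (\<lambda>t. central_flow t q)"
      unfolding curve top_of_quotient
      using cont continuous_map_proj by (intro continuous_map_compose) auto
  next
    fix c t assume "c \<in> atlas (quotient_manifold \<Gamma>)" and t: "central_flow t q \<in> fst c"
    then obtain W where W: "open W" "inj_on \<pi> W" and c: "c = section_chart W" using atlas_iff by auto
    have "\<pi> (p + (0, t)) \<in> \<pi> ` W" using t by (simp add: c q central_flow_proj)
    then obtain a N where N: "a \<in> \<Gamma>" "open N" "t \<in> N" "N \<subseteq> UNIV" "\<And>r. r \<in> N \<Longrightarrow>
        \<pi> (p + (0, r)) \<in> \<pi> ` W \<and> inv_into W \<pi> (\<pi> (p + (0, r))) = a \<star> (p + (0, r))"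
      by (rule local_lift[OF W open_UNIV cont UNIV_I]) (rule that)
    have "((\<lambda>r. a \<star> p + (0, r)) has_vector_derivative (0, 1)) (at t)"
      by (auto intro!: derivative_eq_intros simp: zero_prod_def)
    then have "((snd c \<circ> (\<lambda>t. central_flow t q)) has_vector_derivative (0, 1)) (at t)"
      by (rule has_vector_derivative_transform_within_open[OF _ N(2,3)])
        (simp add: N(5) c q central_flow_proj mult_SolR_add_central)
    then show "((snd c \<circ> (\<lambda>t. central_flow t q)) has_vector_derivative
        quotient_field central_field c (central_flow t q)) (at t)"
      by (simp add: quotient_field_def central_field_eq)
  qed
qed (simp_all add: central_flow_0 central_flow_add)

text \<open>In a chart the projected curve is locally \<open>r \<mapsto> a \<star> escaping_curve r\<close>, and the induced metric
  has the same coefficients as the metric of the group.\<close>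

lemma proj_escaping_geodesic:
  "geodesic_on (quotient_manifold \<Gamma>) (quotient_metric sol_metric) {0<..} (\<pi> \<circ> escaping_curve)"
  unfolding geodesic_on_def
proof (intro conjI ballI impI)
  show "continuous_map (top_of_set {0<..}) (top_of (quotient_manifold \<Gamma>)) (\<pi> \<circ> escaping_curve)"
    unfolding top_of_quotient
    using continuous_on_escaping_curve continuous_map_proj by (intro continuous_map_compose) auto
next
  fix c t
  assume "c \<in> atlas (quotient_manifold \<Gamma>)" and t: "t \<in> {0<..}" "(\<pi> \<circ> escaping_curve) t \<in> fst c"
  then obtain W where W: "open W" "inj_on \<pi> W" and c: "c = section_chart W" using atlas_iff by auto
  have "\<pi> (escaping_curve t) \<in> \<pi> ` W" using t by (simp add: c)
  then obtain a N where "a \<in> \<Gamma>" and N: "open N" "t \<in> N" "N \<subseteq> {0<..}"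
      "\<And>r. r \<in> N \<Longrightarrow> \<pi> (escaping_curve r) \<in> \<pi> ` W \<and> inv_into W \<pi> (\<pi> (escaping_curve r)) = a \<star> escaping_curve r"
    by (rule local_lift[OF W open_greaterThan continuous_on_escaping_curve t(1)]) (rule that)
  have "((snd c \<circ> (\<pi> \<circ> escaping_curve)) has_vector_derivative escaping_velocity a r) (at r)" if "r \<in> N" for r
  proof -
    have "r > 0" using N(3) that by auto
    show ?thesis
      by (rule has_vector_derivative_transform_within_open[OF escaping_curve_has_velocity[OF \<open>r > 0\<close>] N(1) that])
        (simp add: N(4) c)
  qed
  then have ev: "\<forall>\<^sub>F r in nhds t. ((snd c \<circ> (\<pi> \<circ> escaping_curve)) has_vector_derivative escaping_velocity a r) (at r)"
    using N(1,2) by (auto simp: eventually_nhds)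
  have at_t: "snd c ((\<pi> \<circ> escaping_curve) t) = a \<star> escaping_curve t"
    using N(2,4) by (simp add: c)
  have "a \<star> escaping_curve t \<in> W"
    using N(2,4) inv_into_into[of "\<pi> (escaping_curve t)" \<pi> W] by metis
  then have "christoffel (\<lambda>x. quotient_metric sol_metric c (chart_inv c x)) (a \<star> escaping_curve t)
      = christoffel sol_metric (a \<star> escaping_curve t)"
    by (intro ext christoffel_germ[OF W(1)])
      (use snd_chart_inv[OF W(2)] in \<open>simp_all add: quotient_metric_def c\<close>)
  then show "\<exists>v. (\<forall>\<^sub>F s in nhds t. ((snd c \<circ> (\<pi> \<circ> escaping_curve)) has_vector_derivative v s) (at s)) \<and>
      (v has_vector_derivative - christoffel (\<lambda>x. quotient_metric sol_metric c (chart_inv c x))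
         (snd c ((\<pi> \<circ> escaping_curve) t)) (v t) (v t)) (at t)"
    unfolding at_t using ev escaping_velocity_geodesic[of t a] t(1) by auto
qed

lemma incomplete_quotient:
  "\<not> geodesically_complete (quotient_manifold \<Gamma>) (quotient_metric sol_metric)"
proof
  assume "geodesically_complete (quotient_manifold \<Gamma>) (quotient_metric sol_metric)"
  moreover have "open {0::real<..} \<and> is_interval {0::real<..} \<and> {0::real<..} \<noteq> {}"
    by (auto simp: is_interval_1 intro: exI[of _ 1])
  ultimately obtain \<gamma> where \<gamma>: "geodesic_on (quotient_manifold \<Gamma>) (quotient_metric sol_metric) UNIV \<gamma>"
    "\<forall>t\<in>{0<..}. \<gamma> t = (\<pi> \<circ> escaping_curve) t"
    unfolding geodesically_complete_def using proj_escaping_geodesic by blast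
  have cont: "continuous_map euclidean Q \<gamma>"
    using \<gamma>(1) by (simp add: geodesic_on_def top_of_quotient)
  then have "range \<gamma> \<subseteq> range \<pi>"
    using continuous_map_image_subset_topspace[OF cont] by (simp add: topspace_Q)
  then obtain p where p: "\<gamma> 0 = \<pi> p"
    by blast
  obtain U where U: "open U" "p \<in> U" "inj_on \<pi> U" by (rule locally_injective)
  let ?c = "section_chart U"
  have c: "?c \<in> atlas (quotient_manifold \<Gamma>)" "\<gamma> 0 \<in> fst ?c"
    using U p atlas_iff by auto
  obtain v w where v: "\<forall>\<^sub>F s in nhds 0. ((snd ?c \<circ> \<gamma>) has_vector_derivative v s) (at s)"
      "(v has_vector_derivative w) (at 0)"
    using \<gamma>(1) c unfolding geodesic_on_def by blast
  let ?D = "\<gamma> -` (\<pi> ` U)"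
  have "open ?D"
    using cont openin_proj_image[OF U(1)] by (auto simp: continuous_map_def vimage_def)
  then have "\<forall>\<^sub>F s in nhds 0. s \<in> ?D"
    by (rule eventually_nhds_in_open) (use U p in auto)
  then have "\<forall>\<^sub>F s in at_right 0. s \<in> ?D"
    using at_within_le_nhds by (rule filter_leD[rotated])
  then have "\<forall>\<^sub>F s in at_right 0. \<exists>a. \<forall>\<^sub>F r in nhds s. (snd ?c \<circ> \<gamma>) r = a \<star> escaping_curve r"
    using eventually_at_right_less[of "0::real"]
  proof eventually_elim
    case (elim s)
    then have s: "s \<in> {0<..}" "\<pi> (escaping_curve s) \<in> \<pi> ` U" using \<gamma>(2) by auto
    obtain a N where "a \<in> \<Gamma>" and N: "open N" "s \<in> N" "N \<subseteq> {0<..}" "\<And>r. r \<in> N \<Longrightarrow>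
        \<pi> (escaping_curve r) \<in> \<pi> ` U \<and> inv_into U \<pi> (\<pi> (escaping_curve r)) = a \<star> escaping_curve r"
      by (rule local_lift[OF U(1,3) open_greaterThan continuous_on_escaping_curve s]) (rule that)
    then have "\<forall>r\<in>N. (snd ?c \<circ> \<gamma>) r = a \<star> escaping_curve r"
      using \<gamma>(2) by auto
    then have "\<forall>\<^sub>F r in nhds s. (snd ?c \<circ> \<gamma>) r = a \<star> escaping_curve r"
      using N(1,2) unfolding eventually_nhds by blast
    then show ?case by blast
  qed
  then show False
    using escaping_curve_not_extendible v by blast
qed

end


section \<open>The group as a Lorentzian manifold\<close>

lemma id_chart:
  "smooth_on S (id :: solR \<Rightarrow> solR)" "frechet_derivative (id :: solR \<Rightarrow> solR) (at p) = id"
  using smooth_on_affine[OF bounded_linear_ident, of S "0 :: solR"]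
    frechet_derivative_at[OF has_derivative_id, of p]
  by (simp_all add: id_def)

lemma lorentzian_SolR: "lorentzian_manifold SolR_manifold (\<lambda>_. sol_metric)"
proof -
  have "smooth_manifold SolR_manifold"
    by (simp add: smooth_manifold_def SolR_manifold_def second_countable_euclidean is_chart_def
        transition_def id_chart)
  then show ?thesis
    by (simp add: lorentzian_manifold_def SolR_manifold_def lorentz_form_sol_metric transition_def
        smooth_on_sol_metric id_chart)
qed

lemma incomplete_SolR: "\<not> geodesically_complete SolR_manifold (\<lambda>_. sol_metric)"
proof
  assume complete: "geodesically_complete SolR_manifold (\<lambda>_. sol_metric)"
  have one: "\<one>\<^bsub>SolR\<^esub> \<star> p = p" for p by simp
  have "geodesic_on SolR_manifold (\<lambda>_. sol_metric) {0<..} escaping_curve"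
    unfolding geodesic_on_def SolR_manifold_def
  proof (simp, intro conjI ballI continuous_on_escaping_curve)
    fix t :: real assume t: "t \<in> {0<..}"
    have vel: "(escaping_curve has_vector_derivative escaping_velocity \<one>\<^bsub>SolR\<^esub> s) (at s)" if "s > 0" for s
      using escaping_curve_has_velocity[OF that, of "\<one>\<^bsub>SolR\<^esub>"] by (simp only: one)
    have "\<forall>\<^sub>F s in nhds t. s \<in> {0<..}"
      using t by (intro eventually_nhds_in_open) auto
    then have "\<forall>\<^sub>F s in nhds t. (escaping_curve has_vector_derivative escaping_velocity \<one>\<^bsub>SolR\<^esub> s) (at s)"
      by eventually_elim (simp add: vel)
    moreover have "(escaping_velocity \<one>\<^bsub>SolR\<^esub> has_vector_derivative - christoffel sol_metric (escaping_curve t)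
        (escaping_velocity \<one>\<^bsub>SolR\<^esub> t) (escaping_velocity \<one>\<^bsub>SolR\<^esub> t)) (at t)"
      using escaping_velocity_geodesic[of t "\<one>\<^bsub>SolR\<^esub>"] t by (simp only: one greaterThan_iff)
    ultimately show "\<exists>v. (\<forall>\<^sub>F s in nhds t. (escaping_curve has_vector_derivative v s) (at s)) \<and>
        (v has_vector_derivative - christoffel sol_metric (escaping_curve t) (v t) (v t)) (at t)"
      by blast
  qed
  moreover have "open {0::real<..} \<and> is_interval {0::real<..} \<and> {0::real<..} \<noteq> {}"
    by (auto simp: is_interval_1 intro: exI[of _ 1])
  ultimately obtain \<gamma> where \<gamma>: "geodesic_on SolR_manifold (\<lambda>_. sol_metric) UNIV \<gamma>"
    "\<forall>t\<in>{0<..}. \<gamma> t = escaping_curve t"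
    using complete unfolding geodesically_complete_def by blast
  obtain v w where v: "\<forall>\<^sub>F s in nhds 0. (\<gamma> has_vector_derivative v s) (at s)"
      "(v has_vector_derivative w) (at 0)"
  proof -
    have "\<exists>v. (\<forall>\<^sub>F s in nhds 0. (\<gamma> has_vector_derivative v s) (at s)) \<and>
        (v has_vector_derivative - christoffel sol_metric (\<gamma> 0) (v 0) (v 0)) (at 0)"
      using \<gamma>(1) by (simp add: geodesic_on_def SolR_manifold_def)
    then show ?thesis using that by blast
  qed
  have "\<forall>\<^sub>F s in at_right 0. \<exists>a. \<forall>\<^sub>F r in nhds s. \<gamma> r = a \<star> escaping_curve r"
    using eventually_at_right_less[of "0::real"]
  proof eventually_elim
    case (elim s)
    have "\<forall>\<^sub>F r in nhds s. r \<in> {0<..}"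
      using elim by (intro eventually_nhds_in_open) auto
    then have "\<forall>\<^sub>F r in nhds s. \<gamma> r = \<one>\<^bsub>SolR\<^esub> \<star> escaping_curve r"
      by eventually_elim (simp add: \<gamma>(2) del: greaterThan_iff)
    then show ?case by blast
  qed
  then show False
    using escaping_curve_not_extendible v by blast
qed


section \<open>A cocompact lattice\<close>

definition golden :: real where "golden = (1 + sqrt 5) / 2"
definition golden_conj :: real where "golden_conj = (1 - sqrt 5) / 2"

text \<open>The logarithm of the unit \<open>\<phi>\<^sup>2 = \<phi> + 1\<close>. The unit \<open>\<phi>\<close> itself would not do: it has norm \<open>-1\<close>, while
  the action of \<open>t\<close> on the plane has determinant \<open>1\<close>.\<close>

definition golden_log :: real where "golden_log = ln (golden + 1)"

text \<open>The ring \<open>\<int>[\<phi>]\<close>, embedded in the plane by its two real embeddings.\<close>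

definition golden_integers :: "(real \<times> real) set" where
  "golden_integers = {(of_int a + of_int b * golden, of_int a + of_int b * golden_conj) | a b. True}"

definition golden_lattice :: "solR set" where
  "golden_lattice = {((of_int n * golden_log, w), of_int m) | n w m. w \<in> golden_integers}"

lemma golden_squares: "golden * golden = golden + 1" "golden_conj * golden_conj = golden_conj + 1"
  by (simp_all add: golden_def golden_conj_def field_simps)

lemma golden_sum: "golden_conj = 1 - golden"
  by (simp add: golden_def golden_conj_def field_simps)

lemma golden_pos: "golden > 1"
proof -
  have "sqrt 1 < sqrt 5" by (subst real_sqrt_less_iff) simp
  then show ?thesis by (simp add: golden_def)
qed

lemma golden_log_pos: "golden_log > 0"
  using golden_pos by (simp add: golden_log_def)

lemma exp_golden_log: "exp golden_log = golden + 1" "exp (- golden_log) = golden_conj + 1"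
proof -
  show "exp golden_log = golden + 1"
    using golden_pos by (simp add: golden_log_def)
  moreover have "(golden_conj + 1) * (golden + 1) = 1"
    using golden_squares(1) by (simp add: golden_sum algebra_simps)
  ultimately show "exp (- golden_log) = golden_conj + 1"
    using golden_pos by (simp add: exp_minus field_simps)
qed

lemma golden_integersI:
  "x = of_int a + of_int b * golden \<Longrightarrow> y = of_int a + of_int b * golden_conj \<Longrightarrow> (x, y) \<in> golden_integers"
  by (auto simp: golden_integers_def)

lemma golden_integersE:
  assumes "(x, y) \<in> golden_integers"
  obtains a b where "x = of_int a + of_int b * golden" "y = of_int a + of_int b * golden_conj"
  using assms by (auto simp: golden_integers_def)

lemma golden_integers_add:
  assumes "(x, y) \<in> golden_integers" "(x', y') \<in> golden_integers"
  shows "(x + x', y + y') \<in> golden_integers"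
proof -
  obtain a b where 1: "x = of_int a + of_int b * golden" "y = of_int a + of_int b * golden_conj"
    using assms(1) by (rule golden_integersE)
  obtain c d where 2: "x' = of_int c + of_int d * golden" "y' = of_int c + of_int d * golden_conj"
    using assms(2) by (rule golden_integersE)
  show ?thesis
    by (rule golden_integersI[of _ "a + c" "b + d"]) (simp_all add: 1 2 algebra_simps)
qed

lemma golden_integers_minus:
  assumes "(x, y) \<in> golden_integers"
  shows "(- x, - y) \<in> golden_integers"
proof -
  obtain a b where 1: "x = of_int a + of_int b * golden" "y = of_int a + of_int b * golden_conj"
    using assms by (rule golden_integersE)
  show ?thesis
    by (rule golden_integersI[of _ "- a" "- b"]) (simp_all add: 1)
qed

text \<open>The conjugate of the unit \<open>\<phi>\<^sup>2\<close> is its inverse \<open>2 - \<phi>\<close>, so multiplication by the unit and by its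
  inverse, which both preserve the ring, are \<open>diag(e\<^sup>\<tau>, e\<^sup>-\<^sup>\<tau>)\<close> and its inverse.\<close>

lemma golden_integers_unit:
  assumes "(x, y) \<in> golden_integers"
  shows "(exp golden_log * x, exp (- golden_log) * y) \<in> golden_integers"
    and "(exp (- golden_log) * x, exp golden_log * y) \<in> golden_integers"
proof -
  obtain a b where ab: "x = of_int a + of_int b * golden" "y = of_int a + of_int b * golden_conj"
    using assms by (rule golden_integersE)
  have unit: "(z + 1) * (of_int a + of_int b * z) = of_int (a + b) + of_int (a + 2 * b) * z"
    if "z * z = z + 1" for z :: real
  proof -
    have "(z + 1) * (of_int a + of_int b * z) = of_int a * z + of_int a + of_int b * (z * z) + of_int b * z"
      by (simp add: algebra_simps)
    also have "\<dots> = of_int (a + b) + of_int (a + 2 * b) * z"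
      unfolding that by (simp add: algebra_simps)
    finally show ?thesis .
  qed
  have inverse_unit: "(2 - z) * (of_int a + of_int b * z) = of_int (2 * a - b) + of_int (b - a) * z"
    if "z * z = z + 1" for z :: real
  proof -
    have "(2 - z) * (of_int a + of_int b * z) = 2 * of_int a - of_int a * z - of_int b * (z * z) + 2 * of_int b * z"
      by (simp add: algebra_simps)
    also have "\<dots> = of_int (2 * a - b) + of_int (b - a) * z"
      unfolding that by (simp add: algebra_simps)
    finally show ?thesis .
  qed
  have conj: "golden_conj + 1 = 2 - golden" "golden + 1 = 2 - golden_conj"
    by (simp_all add: golden_sum)
  show "(exp golden_log * x, exp (- golden_log) * y) \<in> golden_integers"
    unfolding exp_golden_log ab using unit[OF golden_squares(1)] unit[OF golden_squares(2)]
    by (rule golden_integersI)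
  show "(exp (- golden_log) * x, exp golden_log * y) \<in> golden_integers"
    unfolding exp_golden_log ab conj
    using inverse_unit[OF golden_squares(1)] inverse_unit[OF golden_squares(2)]
    by (rule golden_integersI)
qed

lemma golden_integers_exp:
  assumes "(x, y) \<in> golden_integers"
  shows "(exp (of_int n * golden_log) * x, exp (- (of_int n * golden_log)) * y) \<in> golden_integers"
proof -
  have pow: "(exp (of_nat k * golden_log) * x, exp (- (of_nat k * golden_log)) * y) \<in> golden_integers \<and>
    (exp (- (of_nat k * golden_log)) * x, exp (of_nat k * golden_log) * y) \<in> golden_integers" for k
  proof (induction k)
    case 0
    then show ?case using assms by simp
  next
    case (Suc k)
    have "exp (of_nat (Suc k) * golden_log) = exp golden_log * exp (of_nat k * golden_log)"
      "exp (- (of_nat (Suc k) * golden_log)) = exp (- golden_log) * exp (- (of_nat k * golden_log))"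
      by (simp_all add: exp_add[symmetric] algebra_simps)
    then show ?case
      using Suc golden_integers_unit by (simp only: mult.assoc)
  qed
  show ?thesis
  proof (cases n rule: int_cases2)
    case (nonneg k)
    then show ?thesis using pow[of k] by simp
  next
    case (nonpos k)
    then show ?thesis using pow[of k] by simp
  qed
qed

lemma golden_latticeI:
  "(x, y) \<in> golden_integers \<Longrightarrow> ((of_int n * golden_log, x, y), of_int m) \<in> golden_lattice"
  by (auto simp: golden_lattice_def)

lemma golden_latticeE:
  assumes "p \<in> golden_lattice"
  obtains n x y m where "p = ((of_int n * golden_log, x, y), of_int m)" "(x, y) \<in> golden_integers"
  using assms by (auto simp: golden_lattice_def)

lemma subgroup_golden_lattice: "subgroup golden_lattice SolR"
proof (rule SolR.subgroupI)
  have "(0, 0) \<in> golden_integers"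
    by (rule golden_integersI[of _ 0 0]) simp_all
  then show "golden_lattice \<noteq> {}"
    using golden_latticeI by blast
next
  fix p assume "p \<in> golden_lattice"
  then obtain n x y m where p: "p = ((of_int n * golden_log, x, y), of_int m)" "(x, y) \<in> golden_integers"
    by (rule golden_latticeE)
  have "(- (exp (of_int (- n) * golden_log) * x), - (exp (- (of_int (- n) * golden_log)) * y)) \<in> golden_integers"
    using p(2) by (intro golden_integers_minus golden_integers_exp)
  then show "inv\<^bsub>SolR\<^esub> p \<in> golden_lattice"
    using golden_latticeI[of _ _ "- n" "- m"] by (simp add: inv_SolR p(1))
next
  fix p q assume "p \<in> golden_lattice" "q \<in> golden_lattice"
  then obtain n x y m n' x' y' m' where
      p: "p = ((of_int n * golden_log, x, y), of_int m)" "(x, y) \<in> golden_integers" and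
      q: "q = ((of_int n' * golden_log, x', y'), of_int m')" "(x', y') \<in> golden_integers"
    by (metis golden_latticeE)
  have "(x + exp (of_int n * golden_log) * x', y + exp (- (of_int n * golden_log)) * y') \<in> golden_integers"
    using p(2) q(2) by (intro golden_integers_add golden_integers_exp)
  then show "p \<star> q \<in> golden_lattice"
    using golden_latticeI[of _ _ "n + n'" "m + m'"] by (simp add: mult_SolR p(1) q(1) algebra_simps)
qed simp

lemma int_abs_less_1: "\<bar>real_of_int k\<bar> < 1 \<Longrightarrow> k = 0"
  by linarith

text \<open>The two embeddings of \<open>a + b \<phi>\<close> differ by \<open>b \<surd>5\<close>, so if both are small, then first \<open>b\<close> and then
  \<open>a\<close> must vanish.\<close>

lemma golden_integers_separated:
  assumes "(x, y) \<in> golden_integers" "\<bar>x\<bar> < 1 / 2" "\<bar>y\<bar> < 1 / 2"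
  shows "x = 0 \<and> y = 0"
proof -
  obtain a b where ab: "x = of_int a + of_int b * golden" "y = of_int a + of_int b * golden_conj"
    using assms(1) by (rule golden_integersE)
  have "x - y = of_int b * sqrt 5"
    by (simp add: ab golden_def golden_conj_def field_simps)
  then have "\<bar>of_int b\<bar> * sqrt 5 < 1"
    using assms(2,3) by (simp add: abs_mult[symmetric])
  moreover have "\<bar>of_int b\<bar> * 1 \<le> \<bar>of_int b\<bar> * sqrt (5::real)"
    by (intro mult_left_mono) simp_all
  ultimately have "b = 0" by (intro int_abs_less_1) simp
  moreover from this have "a = 0" using assms(2) ab by (intro int_abs_less_1) simp
  ultimately show ?thesis by (simp add: ab)
qed

lemma discrete_golden_lattice: "discrete golden_lattice"
  unfolding discrete_def isolated_in_dist_Ex_iff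
proof (intro ballI conjI exI impI)
  let ?e = "min golden_log (1 / 2)"
  show "?e > 0" using golden_log_pos by simp
  fix p q assume p: "p \<in> golden_lattice" and q: "q \<in> golden_lattice" and d: "dist p q < ?e"
  obtain n x y m where p: "p = ((of_int n * golden_log, x, y), of_int m)" "(x, y) \<in> golden_integers"
    using p by (rule golden_latticeE)
  obtain n' x' y' m' where q: "q = ((of_int n' * golden_log, x', y'), of_int m')" "(x', y') \<in> golden_integers"
    using q by (rule golden_latticeE)
  have "dist (T_of p) (T_of q) < ?e" "dist (X_of p) (X_of q) < ?e" "dist (Y_of p) (Y_of q) < ?e" "dist (Z_of p) (Z_of q) < ?e"
    using d dist_fst_le[of p q] dist_snd_le[of p q] dist_fst_le[of "fst p" "fst q"] dist_snd_le[of "fst p" "fst q"]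
      dist_fst_le[of "snd (fst p)" "snd (fst q)"] dist_snd_le[of "snd (fst p)" "snd (fst q)"]
    by linarith+
  then have *: "\<bar>of_int n * golden_log - of_int n' * golden_log\<bar> < golden_log" "\<bar>x - x'\<bar> < 1 / 2" "\<bar>y - y'\<bar> < 1 / 2"
    "\<bar>real_of_int m - of_int m'\<bar> < 1 / 2"
    by (simp_all add: p(1) q(1) dist_real_def)
  have "\<bar>of_int n * golden_log - of_int n' * golden_log\<bar> = \<bar>of_int (n - n')\<bar> * golden_log"
    using golden_log_pos by (simp add: left_diff_distrib[symmetric] abs_mult)
  with *(1) have "\<bar>real_of_int (n - n')\<bar> < 1"
    using golden_log_pos by simp
  then have "n = n'" using int_abs_less_1[of "n - n'"] by simp
  moreover have "m = m'" using *(4) int_abs_less_1[of "m - m'"] by simp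
  moreover have "(x - x', y - y') \<in> golden_integers"
    using golden_integers_add[OF p(2) golden_integers_minus[OF q(2)]] by simp
  then have "x = x'" "y = y'"
    using golden_integers_separated[of "x - x'" "y - y'"] *(2,3) by simp_all
  ultimately show "q = p" by (simp add: p(1) q(1))
qed

text \<open>Rounding down, first \<open>t\<close> modulo \<open>\<tau>\<close>, then \<open>x - y\<close> modulo \<open>\<surd>5\<close> by the choice of \<open>b\<close>, then \<open>x\<close>
  modulo \<open>1\<close> by the choice of \<open>a\<close>, and \<open>z\<close> modulo \<open>1\<close>, moves every point into a compact box.\<close>

lemma cocompact_golden_lattice: "cocompact_lattice golden_lattice"
proof -
  interpret discrete_subgroup golden_lattice
    by (simp add: discrete_subgroup_def subgroup_golden_lattice discrete_golden_lattice)
  let ?K = "({0..golden_log} \<times> {0..1} \<times> {- sqrt 5..1}) \<times> {0..1} :: solR set"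
  have "\<exists>a\<in>golden_lattice. a \<star> p \<in> ?K" for p
  proof -
    define n where "n = \<lfloor>T_of p / golden_log\<rfloor>"
    define m where "m = \<lfloor>Z_of p\<rfloor>"
    \<comment> \<open>The plane is first scaled by the action of \<open>- n \<tau>\<close> and then translated, so \<open>b\<close> and \<open>a\<close> are
      chosen for the scaled coordinates.\<close>
    define x where "x = exp (- (of_int n * golden_log)) * X_of p"
    define y where "y = exp (of_int n * golden_log) * Y_of p"
    define b where "b = \<lfloor>(x - y) / sqrt 5\<rfloor>"
    define a where "a = \<lfloor>x - of_int b * golden\<rfloor>"
    let ?g = "((of_int (- n) * golden_log, of_int (- a) + of_int (- b) * golden,
      of_int (- a) + of_int (- b) * golden_conj), of_int (- m)) :: solR"
    have fl: "of_int \<lfloor>u\<rfloor> \<le> u" "u \<le> of_int \<lfloor>u\<rfloor> + 1" for u :: real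
      by linarith+
    have "of_int n * golden_log \<le> T_of p" "T_of p \<le> (of_int n + 1) * golden_log"
      using golden_log_pos fl[of "T_of p / golden_log", folded n_def]
      by (simp_all add: pos_le_divide_eq pos_divide_le_eq)
    then have T: "T_of p - of_int n * golden_log \<in> {0..golden_log}"
      by (simp add: algebra_simps)
    have Z: "Z_of p - of_int m \<in> {0..1}"
      using fl[of "Z_of p", folded m_def] by simp
    have X: "x - of_int b * golden - of_int a \<in> {0..1}"
      using fl[of "x - of_int b * golden", folded a_def] by simp
    have "0 < sqrt (5 :: real)" by simp
    then have "of_int b * sqrt 5 \<le> x - y" "x - y \<le> (of_int b + 1) * sqrt 5"
      using fl[of "(x - y) / sqrt 5", folded b_def] by (simp_all add: pos_le_divide_eq pos_divide_le_eq)
    moreover have "y - of_int b * golden_conj - of_int a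
        = (x - of_int b * golden - of_int a) - (x - y - of_int b * sqrt 5)"
      by (simp add: golden_def golden_conj_def field_simps)
    ultimately have Y: "y - of_int b * golden_conj - of_int a \<in> {- sqrt 5..1}"
      using X by (simp add: algebra_simps)
    have "?g \<star> p = ((T_of p - of_int n * golden_log, x - of_int b * golden - of_int a,
        y - of_int b * golden_conj - of_int a), Z_of p - of_int m)"
      by (simp add: mult_SolR x_def y_def)
    moreover have "?g \<in> golden_lattice"
      by (rule golden_latticeI, rule golden_integersI[of _ "- a" "- b"]) simp_all
    ultimately show ?thesis
      using T X Y Z by (intro bexI[of _ ?g]) (simp_all only: mem_Times_iff fst_conv snd_conv simp_thms)
  qed
  then have "range \<pi> \<subseteq> \<pi> ` ?K"
    using proj_mult by (metis (no_types, lifting) image_eqI image_subsetI)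
  then have "\<pi> ` ?K = topspace Q"
    unfolding topspace_Q by blast
  moreover have "compactin euclidean ?K"
    by (simp add: compactin_euclidean_iff compact_Times)
  then have "compactin Q (\<pi> ` ?K)"
    using continuous_map_proj by (rule image_compactin)
  ultimately have "compact_space Q"
    by (simp add: compact_space_def)
  then show ?thesis
    by (simp add: cocompact_lattice_def subgroup_golden_lattice discrete_golden_lattice)
qed


section \<open>Incomplete compact quotients\<close>

theorem theorem1p6:
  shows "\<exists>g V.
    lorentzian_manifold SolR_manifold (\<lambda>_. g) \<and>
    left_invariant_metric g \<and>
    \<not> geodesically_complete SolR_manifold (\<lambda>_. g) \<and>
    central_null_killing g V \<and>
    (\<exists>\<Gamma>. cocompact_lattice \<Gamma>) \<and>
    (\<forall>\<Gamma>. cocompact_lattice \<Gamma> \<longrightarrow>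
       lorentzian_manifold (quotient_manifold \<Gamma>) (quotient_metric g) \<and>
       compact_space (top_of (quotient_manifold \<Gamma>)) \<and>
       \<not> geodesically_complete (quotient_manifold \<Gamma>) (quotient_metric g) \<and>
       smooth_vector_field (quotient_manifold \<Gamma>) (quotient_field V) \<and>
       (\<exists>\<Phi>. is_flow (quotient_manifold \<Gamma>) (quotient_field V) \<Phi> \<and>
          (\<forall>s. isometry (quotient_manifold \<Gamma>) (quotient_metric g) (\<Phi> s))))"
proof (intro exI[of _ sol_metric] exI[of _ central_field] conjI allI impI)
  show "\<exists>\<Gamma>. cocompact_lattice \<Gamma>"
    using cocompact_golden_lattice by blast
next
  fix \<Gamma> assume lattice: "cocompact_lattice \<Gamma>"
  then interpret discrete_subgroup \<Gamma>
    by (simp add: cocompact_lattice_def discrete_subgroup_def)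
  show "lorentzian_manifold (quotient_manifold \<Gamma>) (quotient_metric sol_metric)"
    by (rule lorentzian_quotient)
  show "compact_space (top_of (quotient_manifold \<Gamma>))"
    using lattice by (simp add: cocompact_lattice_def top_of_quotient)
  show "\<not> geodesically_complete (quotient_manifold \<Gamma>) (quotient_metric sol_metric)"
    by (rule incomplete_quotient)
  show "smooth_vector_field (quotient_manifold \<Gamma>) (quotient_field central_field)"
    by (rule smooth_vector_field_quotient)
  show "\<exists>\<Phi>. is_flow (quotient_manifold \<Gamma>) (quotient_field central_field) \<Phi> \<and>
      (\<forall>s. isometry (quotient_manifold \<Gamma>) (quotient_metric sol_metric) (\<Phi> s))"
    using is_flow_central_flow isometry_central_flow by blast
qed (rule lorentzian_SolR left_invariant_sol_metric incomplete_SolR central_null_killing_central_field)+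

end
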